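(* Let $F$ be a $4$-regular graph, let $E\subseteq E(F)$ be based in $F$, let $P$ be a circuit partition of $F$, and let $C$ be an oriented Euler system of $F$. Then $\pi_P(\Gamma_{E,C})$ is an integral cycle spanning set of $\mathrm{Tch}(P)$.
   Context: Graphs: $G=(V,H,E,\epsilon)$ with finite sets of vertices $V$ and half-edges $H$, a partition $E$ of $H$ into unordered pairs (edges), and $\epsilon:H\to V$; loops and multiple edges allowed. $E'\subseteq E(G)$ is based in $G$ if it contains exactly one edge of each connected component of $G$. A directed version orders each edge as (tail, head). A single transition is an unordered pair of distinct half-edges incident with a common vertex; a directed single transition is such an ordered pair. A closed walk is a sequence $((h_1,h_2),\dots,(h_{n-1},h_n))$ of directed single transitions with $\{h_2,h_3\},\{h_4,h_5\},\dots,\{h_n,h_1\}$ edges, up to cyclic shift. $\sigma(D,W)\in\mathbb Z^{E}$ counts, at each edge, traversals by $W$ along its direction in $D$ minus traversals against it. An oriented circuit is a nonempty closed walk in which each half-edge occurs at most once; a circuit is one with orientation forgotten. The cycle space of $D$ is the right null space over $\mathbb Q$ of its vertex-edge incidence matrix. A cycle basis is a set $B$ of closed walks such that the $\sigma(D,W)$, $W\in B$, are pairwise distinct and form a basis of the cycle space; a cycle spanning set is a (multi)set of closed walks containing a cycle basis; it is integral if every $\sigma(D,W)$, $W$ a closed walk, lies in the $\mathbb Z$-span of its $\sigma$-vectors. $F$ is $4$-regular if every vertex is incident with exactly $4$ half-edges. A transition at $v$ is a partition of the four half-edges at $v$ into two single transitions. A circuit partition $P$ is a set of circuits of $F$ such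 that every half-edge lies in exactly one single transition of exactly one circuit of $P$; $\tau(P)$ is the set of transitions both of whose single transitions occur in circuits of $P$. The touch-graph $\mathrm{Tch}(P)$ has vertex set $P$, half-edge set the set of single transitions occurring in circuits of $P$, edge set $\tau(P)$, and maps each single transition to the circuit containing it. For a closed walk $W$ of $F$, $\pi_P(W)$ is obtained by replacing each directed single transition $(h,h')$ of $W$ by $(s,s')$, where $s,s'$ are the single transitions of circuits of $P$ containing $h,h'$, and deleting pairs with $s=s'$; it is a closed walk of $\mathrm{Tch}(P)$ in which each remaining $(s,s')$ traverses edge $\{s,s'\}$ from half-edge $s$ to half-edge $s'$. For a set $S$, $\pi_P(S)$ is the multiset $\{\pi_P(W):W\in S\}$. An oriented Euler system of $F$ consists of one oriented Eulerian circuit for each connected component of $F$; it visits each vertex exactly twice. For a vertex $v$, the oriented circuit induced by $C$ at $v$ based on $E$ is the segment from $v$ back to $v$ of the oriented Eulerian circuit of the component of $v$ that does not traverse the edge of $E$ in that component. $\Gamma_{E,C}$ is the set of these oriented circuits over all $v\in V(F)$.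
   Formalization: Projected walks π_P(W), as members of the cycle spanning set and basis, are allowed to turn back along the same half-edge of Tch(P); under the strict definition of closed walk some π_P(W) fail to be closed walks, e.g. when P contains a single-loop circuit. *)

theory Defs
  imports Complex_Main "HOL-Library.Multiset" "HOL-Library.Function_Algebras"
begin

record ('v, 'h) graph =
  verts  :: "'v set"
  hedges :: "'h set"
  edges  :: "'h set set"
  inc    :: "'h \<Rightarrow> 'v"

definition wf_graph :: "('v, 'h) graph \<Rightarrow> bool" where
  "wf_graph G \<longleftrightarrow> finite (verts G) \<and> finite (hedges G)
     \<and> (\<forall>e\<in>edges G. card e = 2 \<and> e \<subseteq> hedges G)
     \<and> (\<forall>h\<in>hedges G. \<exists>!e. e \<in> edges G \<and> h \<in> e)
     \<and> inc G ` hedges G \<subseteq> verts G"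

definition hedges_at :: "('v, 'h) graph \<Rightarrow> 'v \<Rightarrow> 'h set" where
  "hedges_at G v = {h \<in> hedges G. inc G h = v}"

definition four_regular :: "('v, 'h) graph \<Rightarrow> bool" where
  "four_regular G \<longleftrightarrow> (\<forall>v\<in>verts G. card (hedges_at G v) = 4)"

definition adj_rel :: "('v, 'h) graph \<Rightarrow> ('v \<times> 'v) set" where
  "adj_rel G = {(u, v). \<exists>h\<in>hedges G. \<exists>h'\<in>hedges G. {h, h'} \<in> edges G \<and> h \<noteq> h'
                         \<and> inc G h = u \<and> inc G h' = v}"

definition components :: "('v, 'h) graph \<Rightarrow> 'v set set" where
  "components G = {K. \<exists>v\<in>verts G. K = {u \<in> verts G. (v, u) \<in> (adj_rel G)\<^sup>*}}"

definition comp_edges :: "('v, 'h) graph \<Rightarrow> 'v set \<Rightarrow> 'h set set" where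
  "comp_edges G K = {e \<in> edges G. \<forall>h\<in>e. inc G h \<in> K}"

definition comp_hedges :: "('v, 'h) graph \<Rightarrow> 'v set \<Rightarrow> 'h set" where
  "comp_hedges G K = {h \<in> hedges G. inc G h \<in> K}"

definition based :: "('v, 'h) graph \<Rightarrow> 'h set set \<Rightarrow> bool" where
  "based G Eb \<longleftrightarrow> Eb \<subseteq> edges G \<and> (\<forall>K\<in>components G. \<exists>!e. e \<in> Eb \<and> e \<in> comp_edges G K)"

text \<open>A directed version of G: D e is the tail of the edge e; the head is the other half-edge.\<close>
definition orientation :: "('v, 'h) graph \<Rightarrow> ('h set \<Rightarrow> 'h) \<Rightarrow> bool" where
  "orientation G D \<longleftrightarrow> (\<forall>e\<in>edges G. D e \<in> e)"

definition head :: "('h set \<Rightarrow> 'h) \<Rightarrow> 'h set \<Rightarrow> 'h" where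
  "head D e = the_elem (e - {D e})"

text \<open>A closed walk ((h1,h2),...,(h(n-1),hn)) is represented by the list of its directed single
  transitions (taken up to cyclic shift, i.e. any rotation represents the same walk);
  the edges are {h2,h3}, ..., {hn,h1}.\<close>
definition closed_walk :: "('v, 'h) graph \<Rightarrow> ('h \<times> 'h) list \<Rightarrow> bool" where
  "closed_walk G ws \<longleftrightarrow> (\<forall>i<length ws.
      fst (ws ! i) \<in> hedges G \<and> snd (ws ! i) \<in> hedges G \<and> fst (ws ! i) \<noteq> snd (ws ! i)
      \<and> inc G (fst (ws ! i)) = inc G (snd (ws ! i))
      \<and> {snd (ws ! i), fst (ws ! ((i + 1) mod length ws))} \<in> edges G)"

text \<open>The edge traversals of a closed walk: (h, h') means edge {h,h'} traversed from h to h'.\<close>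
definition traversals :: "('h \<times> 'h) list \<Rightarrow> ('h \<times> 'h) list" where
  "traversals ws = map (\<lambda>i. (snd (ws ! i), fst (ws ! ((i + 1) mod length ws)))) [0..<length ws]"

definition sigma_tr :: "('h set \<Rightarrow> 'h) \<Rightarrow> ('h \<times> 'h) list \<Rightarrow> 'h set \<Rightarrow> int" where
  "sigma_tr D ts e = sum_list (map (\<lambda>(a, b). if {a, b} = e then (if D e = a then 1 else -1) else 0) ts)"

definition sigma :: "('h set \<Rightarrow> 'h) \<Rightarrow> ('h \<times> 'h) list \<Rightarrow> 'h set \<Rightarrow> int" where
  "sigma D ws = sigma_tr D (traversals ws)"

text \<open>A closed walk given by its cyclic sequence of edge traversals (the form in which the paper
  presents projected walks pi_P(W) in the touch-graph).\<close>
definition trav_walk :: "('v, 'h) graph \<Rightarrow> ('h \<times> 'h) list \<Rightarrow> bool" where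
  "trav_walk G ts \<longleftrightarrow> (\<forall>i<length ts.
      {fst (ts ! i), snd (ts ! i)} \<in> edges G \<and> fst (ts ! i) \<noteq> snd (ts ! i)
      \<and> inc G (snd (ts ! i)) = inc G (fst (ts ! ((i + 1) mod length ts))))"

definition incid :: "('v, 'h) graph \<Rightarrow> ('h set \<Rightarrow> 'h) \<Rightarrow> 'v \<Rightarrow> 'h set \<Rightarrow> int" where
  "incid G D v e = (if inc G (head D e) = v then 1 else 0) - (if inc G (D e) = v then 1 else 0)"

definition cycle_space :: "('v, 'h) graph \<Rightarrow> ('h set \<Rightarrow> 'h) \<Rightarrow> ('h set \<Rightarrow> rat) set" where
  "cycle_space G D = {x. (\<forall>e. e \<notin> edges G \<longrightarrow> x e = 0)
      \<and> (\<forall>v\<in>verts G. (\<Sum>e\<in>edges G. of_int (incid G D v e) * x e) = 0)}"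

definition qscale :: "rat \<Rightarrow> ('h set \<Rightarrow> rat) \<Rightarrow> ('h set \<Rightarrow> rat)" where
  "qscale c f = (\<lambda>e. c * f e)"

definition zscale :: "int \<Rightarrow> ('h set \<Rightarrow> int) \<Rightarrow> ('h set \<Rightarrow> int)" where
  "zscale c f = (\<lambda>e. c * f e)"

definition qvec :: "('h set \<Rightarrow> int) \<Rightarrow> ('h set \<Rightarrow> rat)" where
  "qvec f = (\<lambda>e. of_int (f e))"

definition cycle_basis :: "('v, 'h) graph \<Rightarrow> ('h set \<Rightarrow> 'h) \<Rightarrow> ('h \<times> 'h) list set \<Rightarrow> bool" where
  "cycle_basis G D B \<longleftrightarrow> (\<forall>W\<in>B. trav_walk G W)
     \<and> inj_on (sigma_tr D) B
     \<and> \<not> module.dependent qscale ((qvec \<circ> sigma_tr D) ` B)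
     \<and> module.span qscale ((qvec \<circ> sigma_tr D) ` B) = cycle_space G D"

definition cycle_spanning_set :: "('v, 'h) graph \<Rightarrow> ('h set \<Rightarrow> 'h) \<Rightarrow> ('h \<times> 'h) list multiset \<Rightarrow> bool" where
  "cycle_spanning_set G D S \<longleftrightarrow> (\<forall>W\<in>#S. trav_walk G W)
     \<and> (\<exists>B. B \<subseteq> set_mset S \<and> cycle_basis G D B)"

definition integral :: "('v, 'h) graph \<Rightarrow> ('h set \<Rightarrow> 'h) \<Rightarrow> ('h \<times> 'h) list multiset \<Rightarrow> bool" where
  "integral G D S \<longleftrightarrow> (\<forall>W. closed_walk G W \<longrightarrow>
      sigma D W \<in> module.span zscale (sigma_tr D ` set_mset S))"

text \<open>The notions do not depend on the chosen directed version; we require them for every one.\<close>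
definition integral_cycle_spanning_set :: "('v, 'h) graph \<Rightarrow> ('h \<times> 'h) list multiset \<Rightarrow> bool" where
  "integral_cycle_spanning_set G S \<longleftrightarrow>
     (\<forall>D. orientation G D \<longrightarrow> cycle_spanning_set G D S \<and> integral G D S)"

definition hedge_list :: "('h \<times> 'h) list \<Rightarrow> 'h list" where
  "hedge_list ws = concat (map (\<lambda>(a, b). [a, b]) ws)"

definition oriented_circuit :: "('v, 'h) graph \<Rightarrow> ('h \<times> 'h) list \<Rightarrow> bool" where
  "oriented_circuit G ws \<longleftrightarrow> closed_walk G ws \<and> ws \<noteq> [] \<and> distinct (hedge_list ws)"

definition rev_walk :: "('h \<times> 'h) list \<Rightarrow> ('h \<times> 'h) list" where
  "rev_walk ws = rev (map (\<lambda>(a, b). (b, a)) ws)"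

text \<open>A circuit: an oriented circuit up to cyclic shift and with orientation forgotten,
  represented as the set of all its representing lists.\<close>
definition circuit_of :: "('h \<times> 'h) list \<Rightarrow> ('h \<times> 'h) list set" where
  "circuit_of ws = {rotate k ws | k. True} \<union> {rotate k (rev_walk ws) | k. True}"

definition is_circuit :: "('v, 'h) graph \<Rightarrow> ('h \<times> 'h) list set \<Rightarrow> bool" where
  "is_circuit G c \<longleftrightarrow> (\<exists>ws. oriented_circuit G ws \<and> c = circuit_of ws)"

definition strans :: "('h \<times> 'h) list set \<Rightarrow> 'h set set" where
  "strans c = {{a, b} | a b. \<exists>ws\<in>c. (a, b) \<in> set ws}"

definition circuit_partition :: "('v, 'h) graph \<Rightarrow> ('h \<times> 'h) list set set \<Rightarrow> bool" where
  "circuit_partition G P \<longleftrightarrow> (\<forall>c\<in>P. is_circuit G c)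
     \<and> (\<forall>h\<in>hedges G. \<exists>!cs. fst cs \<in> P \<and> snd cs \<in> strans (fst cs) \<and> h \<in> snd cs)"

definition single_transition :: "('v, 'h) graph \<Rightarrow> 'v \<Rightarrow> 'h set \<Rightarrow> bool" where
  "single_transition G v s \<longleftrightarrow> card s = 2 \<and> s \<subseteq> hedges_at G v"

definition transition :: "('v, 'h) graph \<Rightarrow> 'v \<Rightarrow> 'h set set \<Rightarrow> bool" where
  "transition G v t \<longleftrightarrow> (\<exists>s1 s2. t = {s1, s2} \<and> single_transition G v s1 \<and> single_transition G v s2
      \<and> s1 \<inter> s2 = {} \<and> s1 \<union> s2 = hedges_at G v)"

definition tau :: "('v, 'h) graph \<Rightarrow> ('h \<times> 'h) list set set \<Rightarrow> 'h set set set" where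
  "tau G P = {t. (\<exists>v\<in>verts G. transition G v t) \<and> t \<subseteq> (\<Union>c\<in>P. strans c)}"

definition Tch :: "('v, 'h) graph \<Rightarrow> ('h \<times> 'h) list set set
                     \<Rightarrow> (('h \<times> 'h) list set, 'h set) graph" where
  "Tch G P = \<lparr> verts = P, hedges = (\<Union>c\<in>P. strans c), edges = tau G P,
               inc = (\<lambda>s. THE c. c \<in> P \<and> s \<in> strans c) \<rparr>"

definition st_of :: "('h \<times> 'h) list set set \<Rightarrow> 'h \<Rightarrow> 'h set" where
  "st_of P h = (THE s. s \<in> (\<Union>c\<in>P. strans c) \<and> h \<in> s)"

text \<open>pi_P(W), given as its sequence of edge traversals in Tch(P).\<close>
definition piP :: "('h \<times> 'h) list set set \<Rightarrow> ('h \<times> 'h) list \<Rightarrow> ('h set \<times> 'h set) list" where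
  "piP P ws = filter (\<lambda>(s, s'). s \<noteq> s') (map (\<lambda>(h, h'). (st_of P h, st_of P h')) ws)"

definition walk_hedges :: "('h \<times> 'h) list \<Rightarrow> 'h set" where
  "walk_hedges ws = set (hedge_list ws)"

text \<open>Each oriented Eulerian circuit is represented by one list (a fixed cyclic rotation).\<close>
definition euler_system :: "('v, 'h) graph \<Rightarrow> ('h \<times> 'h) list set \<Rightarrow> bool" where
  "euler_system G C \<longleftrightarrow>
     (\<forall>ws\<in>C. oriented_circuit G ws \<and> (\<exists>K\<in>components G. walk_hedges ws = comp_hedges G K))
     \<and> (\<forall>K\<in>components G. \<exists>!ws. ws \<in> C \<and> walk_hedges ws = comp_hedges G K)"

text \<open>Segment of ws from the visit i of a vertex back to the visit j of the same vertex,
  closed up by the directed single transition (fst (ws!j), snd (ws!i)).\<close>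
definition seg :: "('h \<times> 'h) list \<Rightarrow> nat \<Rightarrow> nat \<Rightarrow> ('h \<times> 'h) list" where
  "seg ws i j = (fst (ws ! j), snd (ws ! i))
                 # take ((j + length ws - i - 1) mod length ws) (rotate (Suc i) ws)"

definition induced :: "('v, 'h) graph \<Rightarrow> 'h set set \<Rightarrow> ('h \<times> 'h) list set \<Rightarrow> 'v \<Rightarrow> ('h \<times> 'h) list" where
  "induced G Eb C v = (SOME w. \<exists>ws\<in>C. \<exists>i j. i < length ws \<and> j < length ws \<and> i \<noteq> j
       \<and> inc G (fst (ws ! i)) = v \<and> inc G (fst (ws ! j)) = v
       \<and> w = seg ws i j \<and> (\<forall>t\<in>set (traversals w). {fst t, snd t} \<notin> Eb))"

definition Gamma :: "('v, 'h) graph \<Rightarrow> 'h set set \<Rightarrow> ('h \<times> 'h) list set \<Rightarrow> ('h \<times> 'h) list multiset" where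
  "Gamma G Eb C = image_mset (induced G Eb C) (mset_set (verts G))"

end

theory Submission
  imports Defs
begin

text \<open>
  Elements of the cycle space of the touch-graph are lifted to flows on \<open>F\<close>. Given \<open>x\<close> in the kernel of
  the incidence matrix of \<open>Tch(P)\<close> over a commutative ring, look for an antisymmetric function \<open>y\<close> on the
  half-edges of \<open>F\<close> whose sum over each single transition \<open>s\<close> of \<open>P\<close> is \<open>\<plusminus>x\<close>, according to whether \<open>s\<close> is
  the head or the tail of its edge. Along a circuit of \<open>P\<close> the values of \<open>y\<close> are partial sums; they close up
  because \<open>x\<close> has divergence zero at that circuit, and the free additive constant, one per circuit, is used
  to make \<open>y\<close> vanish on \<open>E\<close> (a circuit meets at most one edge of \<open>E\<close>).

  Along an Euler circuit, the flow of the induced circuit at \<open>v\<close> jumps only at the two visits of \<open>v\<close>, by \<open>1\<close>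
  and \<open>-1\<close>, and it vanishes on \<open>E\<close>. Since \<open>y\<close> is conservative, its jumps at the two visits of \<open>v\<close> are
  opposite too. So \<open>y\<close> is the combination of the induced circuits with the jumps of \<open>y\<close> as coefficients:
  the difference has no jumps and vanishes on \<open>E\<close>. Summing over single transitions expresses \<open>x\<close> in terms of
  the \<open>\<pi>\<^sub>P\<close> of the induced circuits. The ring \<open>\<int>\<close> gives integrality, and \<open>\<rat>\<close> gives the span.
\<close>

section \<open>Cyclic sums and the half-edge list of a walk\<close>

lemma sum_cyclic_shift:
  "(\<Sum>i<n. f ((i + 1) mod n)) = (\<Sum>i<n. f i)" for f :: "nat \<Rightarrow> 'a::comm_monoid_add"
proof (cases n)
  case (Suc m)
  have "(\<Sum>i<Suc m. f ((i + 1) mod Suc m)) = (\<Sum>i<m. f (Suc i)) + f 0"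
    by (simp add: sum.lessThan_Suc)
  then show ?thesis
    using Suc by (simp add: sum.lessThan_Suc_shift add.commute del: sum.lessThan_Suc)
qed simp

lemma cyclic_constant:
  fixes f :: "nat \<Rightarrow> 'a"
  assumes "\<And>i. i < n \<Longrightarrow> f i = f ((i + 1) mod n)" "i < n" "j < n"
  shows "f i = f j"
proof -
  have "k < n \<Longrightarrow> f k = f 0" for k
  proof (induction k)
    case (Suc k)
    then have "f k = f 0" "(k + 1) mod n = Suc k" "k < n" by simp_all
    then show ?case using assms(1)[of k] by metis
  qed (rule refl)
  then show ?thesis using assms(2,3) by metis
qed

lemma sum_list_conv_sum_nth:
  "sum_list (map f xs) = (\<Sum>i<length xs. f (xs ! i))" for f :: "'b \<Rightarrow> 'a::comm_monoid_add"
  by (simp add: sum_list_sum_nth atLeast0LessThan)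

lemma length_hedge_list: "length (hedge_list ws) = 2 * length ws"
  by (induction ws) (auto simp: hedge_list_def)

lemma hedge_list_nth:
  "i < length ws \<Longrightarrow> hedge_list ws ! (2 * i) = fst (ws ! i) \<and> hedge_list ws ! (2 * i + 1) = snd (ws ! i)"
proof (induction ws arbitrary: i)
  case (Cons p ws)
  have "hedge_list (p # ws) = fst p # snd p # hedge_list ws"
    by (cases p) (simp add: hedge_list_def)
  then show ?case
    using Cons by (cases i) auto
qed simp

lemma set_hedge_list: "set (hedge_list ws) = fst ` set ws \<union> snd ` set ws"
  by (induction ws) (auto simp: hedge_list_def)

lemma set_hedge_list_nthE:
  assumes "h \<in> set (hedge_list ws)"
  obtains i where "i < length ws" "h = fst (ws ! i) \<or> h = snd (ws ! i)"
  using assms that by (auto simp: set_hedge_list image_iff in_set_conv_nth)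

text \<open>Distinctness in the form used for circuits: a visit is determined by its entry
  \<open>fst\<close>, and also by its exit \<open>snd\<close>, and no half-edge serves as
  both.\<close>

lemma hedge_list_distinctD:
  assumes "distinct (hedge_list ws)" "i < length ws" "j < length ws"
  shows "fst (ws ! i) = fst (ws ! j) \<longleftrightarrow> i = j" "snd (ws ! i) = snd (ws ! j) \<longleftrightarrow> i = j"
    "fst (ws ! i) \<noteq> snd (ws ! j)" "snd (ws ! j) \<noteq> fst (ws ! i)"
proof -
  have eq: "hedge_list ws ! k = hedge_list ws ! l \<longleftrightarrow> k = l" if "k < 2 * length ws" "l < 2 * length ws" for k l
    using assms that by (simp add: nth_eq_iff_index_eq length_hedge_list)
  note nth = hedge_list_nth[OF assms(2)] hedge_list_nth[OF assms(3)]
  show "fst (ws ! i) = fst (ws ! j) \<longleftrightarrow> i = j"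
    using eq[of "2 * i" "2 * j"] nth assms by auto
  show "snd (ws ! i) = snd (ws ! j) \<longleftrightarrow> i = j"
    using eq[of "2 * i + 1" "2 * j + 1"] nth assms by auto
  \<comment> \<open>Entries stand at even positions of \<open>hedge_list\<close>, exits at odd
    ones.\<close>
  have "2 * i \<noteq> 2 * j + 1" by presburger
  then show "fst (ws ! i) \<noteq> snd (ws ! j)"
    using eq[of "2 * i" "2 * j + 1"] nth assms by auto
  then show "snd (ws ! j) \<noteq> fst (ws ! i)" by simp
qed

section \<open>Edges and closed walks\<close>

lemma edge_subset_hedges:
  assumes "wf_graph G" "e \<in> edges G" "h \<in> e"
  shows "h \<in> hedges G"
proof -
  have "e \<subseteq> hedges G" using assms(1,2) by (simp add: wf_graph_def)
  then show ?thesis using assms(3) by (rule subsetD)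
qed

lemma inc_in_verts:
  assumes "wf_graph G" "h \<in> hedges G"
  shows "inc G h \<in> verts G"
proof -
  have "inc G ` hedges G \<subseteq> verts G" using assms(1) by (simp add: wf_graph_def)
  then show ?thesis using assms(2) by (rule image_subset_iff[THEN iffD1, rule_format])
qed

lemma edge_unique:
  assumes "wf_graph G" "e \<in> edges G" "e' \<in> edges G" "h \<in> e" "h \<in> e'"
  shows "e = e'"
proof -
  have "\<exists>!e. e \<in> edges G \<and> h \<in> e"
    using assms(1) edge_subset_hedges[OF assms(1,2,4)] by (simp add: wf_graph_def)
  then show ?thesis using assms(2-5) by (elim ex1E) metis
qed

lemma edge_pairD:
  assumes "wf_graph G" "{a, b} \<in> edges G"
  shows "a \<noteq> b" "a \<in> hedges G" "b \<in> hedges G"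
proof -
  have "card {a, b} = 2" "{a, b} \<subseteq> hedges G" using assms by (auto simp: wf_graph_def)
  then show "a \<noteq> b" "a \<in> hedges G" "b \<in> hedges G" by auto
qed

lemma edgeE:
  assumes "wf_graph G" "e \<in> edges G" "h \<in> e"
  obtains h' where "e = {h, h'}" "h \<noteq> h'"
proof -
  have "card e = 2" using assms by (auto simp: wf_graph_def)
  then obtain a b where "e = {a, b}" "a \<noteq> b" by (auto simp: card_2_iff)
  then show thesis using assms(3) that[of a] that[of b] by auto
qed

lemma closed_walkD:
  assumes "closed_walk G ws" "i < length ws"
  shows "fst (ws ! i) \<in> hedges G" "snd (ws ! i) \<in> hedges G" "fst (ws ! i) \<noteq> snd (ws ! i)"
    "inc G (fst (ws ! i)) = inc G (snd (ws ! i))"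
    "{snd (ws ! i), fst (ws ! ((i + 1) mod length ws))} \<in> edges G"
  using assms unfolding closed_walk_def by blast+

lemma pred_index:
  assumes "i < n"
  obtains k where "k < n" "(k + 1) mod n = (i::nat)"
proof (cases i)
  case 0
  then show thesis using assms that[of "n - 1"] by simp
next
  case (Suc m)
  then show thesis using assms that[of m] by simp
qed

text \<open>An exit is followed by an edge of the walk and an entry is preceded by one. Since a
  half-edge lies on only one edge, that edge is \<open>{h, h'}\<close>.\<close>

lemma closed_walk_edge_closed:
  assumes wf: "wf_graph G" and ws: "closed_walk G ws"
    and h: "h \<in> walk_hedges ws" and e: "{h, h'} \<in> edges G"
  obtains i where "i < length ws"
    "{h, h'} = {snd (ws ! i), fst (ws ! ((i + 1) mod length ws))}"
proof -
  obtain i where i: "i < length ws" "h = fst (ws ! i) \<or> h = snd (ws ! i)"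
    using h by (auto simp: walk_hedges_def elim: set_hedge_list_nthE)
  obtain k where k: "k < length ws" "(k + 1) mod length ws = i"
    using pred_index[OF i(1)] .
  show thesis
    using i(2) that[OF i(1)] that[OF k(1)] edge_unique[OF wf e, of _ h]
      closed_walkD(5)[OF ws i(1)] closed_walkD(5)[OF ws k(1)] k(2)
    by auto
qed

lemma closed_walk_edge_closed':
  assumes "wf_graph G" "closed_walk G ws" "h \<in> walk_hedges ws" "{h, h'} \<in> edges G"
  shows "h' \<in> walk_hedges ws"
proof -
  obtain i where i: "i < length ws" "{h, h'} = {snd (ws ! i), fst (ws ! ((i + 1) mod length ws))}"
    using closed_walk_edge_closed[OF assms] .
  have "(i + 1) mod length ws < length ws" using i(1) by (intro mod_less_divisor) linarith
  then have "fst (ws ! ((i + 1) mod length ws)) \<in> walk_hedges ws" "snd (ws ! i) \<in> walk_hedges ws"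
    using i(1) unfolding walk_hedges_def set_hedge_list by (meson UnI1 UnI2 imageI nth_mem)+
  then show ?thesis using i(2) by (auto simp: doubleton_eq_iff)
qed

subsection \<open>Components\<close>

definition component_of :: "('v, 'h) graph \<Rightarrow> 'v \<Rightarrow> 'v set" where
  "component_of G v = {u \<in> verts G. (v, u) \<in> (adj_rel G)\<^sup>*}"

lemma component_of_in: "v \<in> verts G \<Longrightarrow> component_of G v \<in> components G"
  by (auto simp: component_of_def components_def)

lemma mem_component_of: "v \<in> verts G \<Longrightarrow> v \<in> component_of G v"
  by (simp add: component_of_def)

lemma sym_adj_rel: "sym (adj_rel G)"
proof (rule symI)
  fix u v assume "(u, v) \<in> adj_rel G"
  then obtain h h' where h: "h \<in> hedges G" "h' \<in> hedges G" "{h, h'} \<in> edges G" "h \<noteq> h'"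
      "inc G h = u" "inc G h' = v"
    unfolding adj_rel_def by blast
  then have "{h', h} \<in> edges G" by (simp only: insert_commute)
  then show "(v, u) \<in> adj_rel G" unfolding adj_rel_def using h by blast
qed

lemma component_of_eq:
  assumes "(u, v) \<in> (adj_rel G)\<^sup>*"
  shows "component_of G u = component_of G v"
proof -
  have "(v, u) \<in> (adj_rel G)\<^sup>*"
    using assms sym_adj_rel by (meson sym_rtrancl symD)
  then show ?thesis using assms by (auto simp: component_of_def intro: rtrancl_trans)
qed

lemma components_eq_component_of:
  assumes "K \<in> components G" "v \<in> K"
  shows "K = component_of G v"
proof -
  obtain u where u: "K = component_of G u"
    using assms(1) by (auto simp: components_def component_of_def)
  then have "(u, v) \<in> (adj_rel G)\<^sup>*" using assms(2) by (simp add: component_of_def)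
  then show ?thesis unfolding u by (rule component_of_eq)
qed

lemma component_of_edge:
  assumes "wf_graph G" "{a, b} \<in> edges G"
  shows "component_of G (inc G a) = component_of G (inc G b)"
proof (rule component_of_eq)
  show "(inc G a, inc G b) \<in> (adj_rel G)\<^sup>*"
    using assms edge_pairD[OF assms] by (force simp: adj_rel_def)
qed

lemma comp_edges_iff:
  assumes "wf_graph G" "e \<in> edges G" "h \<in> e" "K \<in> components G"
  shows "e \<in> comp_edges G K \<longleftrightarrow> K = component_of G (inc G h)"
proof
  assume "e \<in> comp_edges G K"
  then have "inc G h \<in> K" using assms(3) by (auto simp: comp_edges_def)
  then show "K = component_of G (inc G h)" by (rule components_eq_component_of[OF assms(4)])
next
  assume K: "K = component_of G (inc G h)"
  obtain h' where h': "e = {h, h'}" using edgeE[OF assms(1-3)] .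
  have "inc G x \<in> component_of G (inc G x)" if "x \<in> e" for x
    using assms(1,2) that by (intro mem_component_of inc_in_verts edge_subset_hedges)
  moreover have "component_of G (inc G h) = component_of G (inc G h')"
    using component_of_edge[OF assms(1)] assms(2) h' by blast
  ultimately have "inc G h \<in> K" "inc G h' \<in> K"
    unfolding K using h' by blast+
  then show "e \<in> comp_edges G K"
    using assms(2) h' by (simp add: comp_edges_def)
qed

text \<open>Neither a transition nor an edge leaves the component, so it is constant around the
  walk.\<close>

lemma closed_walk_component:
  assumes "wf_graph G" "closed_walk G ws" "h \<in> walk_hedges ws" "h' \<in> walk_hedges ws"
  shows "component_of G (inc G h) = component_of G (inc G h')"
proof -
  let ?f = "\<lambda>i. component_of G (inc G (fst (ws ! i)))"
  let ?n = "length ws"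
  have step: "?f i = ?f ((i + 1) mod ?n)" if "i < ?n" for i
    using component_of_edge[OF assms(1) closed_walkD(5)[OF assms(2) that]]
      closed_walkD(4)[OF assms(2) that] by simp
  have "\<exists>i<?n. component_of G (inc G x) = ?f i" if "x \<in> walk_hedges ws" for x
    using that closed_walkD(4)[OF assms(2)]
    by (auto simp: walk_hedges_def elim!: set_hedge_list_nthE)
  then show ?thesis
    using assms(3,4) cyclic_constant[of ?n ?f, OF step] by metis
qed

lemma based_unique:
  assumes "wf_graph G" "based G Eb" "e \<in> Eb" "e' \<in> Eb" "h \<in> e" "h' \<in> e'"
    "component_of G (inc G h) = component_of G (inc G h')"
  shows "e = e'"
proof -
  have e: "e \<in> edges G" "e' \<in> edges G" using assms by (auto simp: based_def)
  then have "inc G h \<in> verts G" using assms(1,5) by (blast intro: inc_in_verts edge_subset_hedges)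
  then have K: "component_of G (inc G h) \<in> components G" by (rule component_of_in)
  have "e \<in> comp_edges G (component_of G (inc G h))" "e' \<in> comp_edges G (component_of G (inc G h))"
    using comp_edges_iff[OF assms(1) _ _ K] e assms(5-7) by blast+
  then show ?thesis using assms(2-4) K unfolding based_def by blast
qed

subsection \<open>Flows of walks\<close>

text \<open>The net number of times \<open>w\<close> leaves a vertex through \<open>h\<close>. It is
  counted on transitions rather than edges, so that it can be compared with \<open>piP\<close> one
  transition at a time.\<close>

definition flow :: "('h \<times> 'h) list \<Rightarrow> 'h \<Rightarrow> int" where
  "flow w h = (\<Sum>(a, b)\<leftarrow>w. of_bool (b = h) - of_bool (a = h))"

text \<open>Shifting the entries by one place pairs each exit with the entry at the other end of its
  edge. Antisymmetry, and vanishing on edges that are not traversed, can be read off this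
  form.\<close>

lemma flow_traversals:
  "flow w h = (\<Sum>(a, b)\<leftarrow>traversals w. of_bool (a = h) - of_bool (b = h))"
proof -
  let ?n = "length w"
  have "(\<Sum>i<?n. of_bool (fst (w ! ((i + 1) mod ?n)) = h)) = (\<Sum>i<?n. of_bool (fst (w ! i) = h) :: int)"
    by (rule sum_cyclic_shift)
  then show ?thesis
    unfolding flow_def sum_list_conv_sum_nth
    by (simp add: traversals_def case_prod_beta sum_subtractf)
qed

lemma traversals_edges:
  "closed_walk G w \<Longrightarrow> (a, b) \<in> set (traversals w) \<Longrightarrow> {a, b} \<in> edges G"
  by (auto simp: traversals_def closed_walk_def)

text \<open>A traversal of \<open>{h, h'}\<close> contributes opposite amounts at the two
  half-edges; every other traversal contributes nothing at either.\<close>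

lemma flow_antisym:
  assumes "wf_graph G" "closed_walk G w" "{h, h'} \<in> edges G"
  shows "flow w h' = - flow w h"
proof -
  have "sum_list (map (\<lambda>(a, b). of_bool (a = h') - of_bool (b = h')) ts) =
      - sum_list (map (\<lambda>(a, b). of_bool (a = h) - of_bool (b = h)) ts :: int list)"
    if "\<And>a b. (a, b) \<in> set ts \<Longrightarrow> {a, b} \<in> edges G" for ts :: "('b \<times> 'b) list"
    using that
  proof (induction ts)
    case (Cons p ts)
    obtain a b where p: "p = (a, b)" by (cases p)
    have e: "{a, b} \<in> edges G" using Cons.prems p by simp
    have "{a, b} = {h, h'}" if "a \<in> {h, h'} \<or> b \<in> {h, h'}"
      using that edge_unique[OF assms(1) e assms(3)] by blast
    moreover have "h \<noteq> h'" "a \<noteq> b" using edge_pairD(1)[OF assms(1)] assms(3) e by auto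
    ultimately have "of_bool (a = h') - of_bool (b = h') = - (of_bool (a = h) - of_bool (b = h) :: int)"
      by (auto simp: doubleton_eq_iff)
    then show ?case using Cons p by simp
  qed simp
  from this[of "traversals w"] show ?thesis
    using traversals_edges[OF assms(2)] by (simp add: flow_traversals)
qed

lemma flow_zero_outside:
  assumes "wf_graph G" "closed_walk G w" "e \<in> edges G" "h \<in> e"
    "\<forall>t\<in>set (traversals w). {fst t, snd t} \<noteq> e"
  shows "flow w h = 0"
proof -
  let ?f = "\<lambda>(a, b). of_bool (a = h) - of_bool (b = h) :: int"
  have "?f (a, b) = 0" if "(a, b) \<in> set (traversals w)" for a b
  proof -
    have "{a, b} \<in> edges G" "{a, b} \<noteq> e" using traversals_edges[OF assms(2) that] assms(5) that by auto
    then have "a \<noteq> h" "b \<noteq> h" using edge_unique[OF assms(1) _ assms(3)] assms(4) by auto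
    then show ?thesis by simp
  qed
  then have "map ?f (traversals w) = map (\<lambda>_. 0) (traversals w)"
    by (intro map_cong refl) auto
  then show ?thesis unfolding flow_traversals by (metis sum_list_0)
qed

lemma flow_eq_zero: "h \<notin> walk_hedges w \<Longrightarrow> flow w h = 0"
  by (induction w) (auto simp: flow_def walk_hedges_def set_hedge_list)

text \<open>A single traversal has as boundary its end vertex minus its start vertex. Each traversal
  starts at the vertex where the preceding one ended, so the boundaries cancel around the
  walk.\<close>

lemma trav_walk_kernel:
  assumes fin: "finite (edges G)"
    and D: "orientation G D" and ts: "trav_walk G ts"
  shows "(\<Sum>e\<in>edges G. incid G D v e * sigma_tr D ts e) = 0"
proof -
  let ?n = "length ts"
  let ?w = "\<lambda>i e. if {fst (ts ! i), snd (ts ! i)} = e then (if D e = fst (ts ! i) then 1 else - 1) else (0::int)"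
  let ?o = "\<lambda>s. of_bool (inc G s = v) :: int"
  have one: "(\<Sum>e\<in>edges G. incid G D v e * ?w i e) = ?o (snd (ts ! i)) - ?o (fst (ts ! i))" if i: "i < ?n" for i
  proof -
    define a b where ab: "a = fst (ts ! i)" "b = snd (ts ! i)"
    have e: "{a, b} \<in> edges G" "a \<noteq> b" using ts i by (auto simp: trav_walk_def ab)
    have "(\<Sum>e\<in>edges G. incid G D v e * ?w i e) = incid G D v {a, b} * (if D {a, b} = a then 1 else - 1)"
      using fin e by (simp add: ab if_distrib[of "\<lambda>x. _ * x"] cong: if_cong)
    moreover have "D {a, b} = a \<or> D {a, b} = b" using D e by (auto simp: orientation_def)
    ultimately show ?thesis
      using e(2) by (auto simp: incid_def head_def ab[symmetric] insert_Diff_if)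
  qed
  have "(\<Sum>e\<in>edges G. incid G D v e * sigma_tr D ts e) = (\<Sum>e\<in>edges G. \<Sum>i<?n. incid G D v e * ?w i e)"
    unfolding sigma_tr_def sum_list_conv_sum_nth by (simp add: sum_distrib_left case_prod_beta)
  also have "\<dots> = (\<Sum>i<?n. \<Sum>e\<in>edges G. incid G D v e * ?w i e)"
    by (rule sum.swap)
  also have "\<dots> = (\<Sum>i<?n. ?o (snd (ts ! i))) - (\<Sum>i<?n. ?o (fst (ts ! i)))"
    using one by (simp add: sum_subtractf)
  also have "(\<Sum>i<?n. ?o (snd (ts ! i))) = (\<Sum>i<?n. ?o (fst (ts ! ((i + 1) mod ?n))))"
    using ts by (intro sum.cong) (auto simp: trav_walk_def)
  also have "\<dots> = (\<Sum>i<?n. ?o (fst (ts ! i)))" by (rule sum_cyclic_shift)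
  finally show ?thesis by simp
qed

text \<open>Integrality speaks of walks given by transitions, whereas the kernel lemma speaks of
  walks given by traversals; this connects the two forms.\<close>

lemma closed_walk_trav_walk:
  assumes two: "\<And>e. e \<in> edges G \<Longrightarrow> card e = 2" and "closed_walk G ws"
  shows "trav_walk G (traversals ws)"
  unfolding trav_walk_def
proof (intro allI impI)
  fix i assume "i < length (traversals ws)"
  then have i: "i < length ws" by (simp add: traversals_def)
  define k where "k = (i + 1) mod length ws"
  have k: "k < length ws" using i unfolding k_def by (intro mod_less_divisor) linarith
  have e: "{snd (ws ! i), fst (ws ! k)} \<in> edges G"
    using closed_walkD(5)[OF assms(2) i] by (simp add: k_def)
  then have "snd (ws ! i) \<noteq> fst (ws ! k)" using two[OF e] by auto
  then show "{fst (traversals ws ! i), snd (traversals ws ! i)} \<in> edges G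
      \<and> fst (traversals ws ! i) \<noteq> snd (traversals ws ! i)
      \<and> inc G (snd (traversals ws ! i)) = inc G (fst (traversals ws ! ((i + 1) mod length (traversals ws))))"
    using e i k closed_walkD(4)[OF assms(2) k] by (simp add: traversals_def k_def)
qed

subsection \<open>Potentials along a circuit\<close>

text \<open>The values of \<open>y\<close> are partial sums of \<open>g\<close> along the circuit,
  with sign plus at exits and minus at entries. They close up because the total is zero, and the
  free constant makes \<open>y\<close> vanish at \<open>e\<close>.\<close>

lemma circuit_potential:
  fixes g :: "'h \<times> 'h \<Rightarrow> 'a::comm_ring_1"
  assumes dist: "distinct (hedge_list ws)" and g0: "(\<Sum>i<length ws. g (ws ! i)) = 0"
  shows "\<exists>y. (\<forall>i<length ws. y (fst (ws ! i)) + y (snd (ws ! i)) = g (ws ! i)) \<and>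
    (\<forall>i<length ws. y (snd (ws ! i)) + y (fst (ws ! ((i + 1) mod length ws))) = 0) \<and>
    (e \<in> walk_hedges ws \<longrightarrow> y e = 0)"
proof -
  let ?n = "length ws"
  define S where "S m = (\<Sum>k<m. g (ws ! k))" for m
  \<comment> \<open>\<open>K\<close> is the free constant. The two conditions say that
    \<open>y e = 0\<close>, with \<open>e\<close> occurring as an exit or as an entry.\<close>
  obtain K where K: "\<And>i. i < ?n \<Longrightarrow> e = snd (ws ! i) \<Longrightarrow> K + S (Suc i) = 0"
      "\<And>i. i < ?n \<Longrightarrow> e = fst (ws ! i) \<Longrightarrow> K + S i = 0"
  proof (cases "e \<in> walk_hedges ws")
    case True
    then obtain i where i: "i < ?n" "e = fst (ws ! i) \<or> e = snd (ws ! i)"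
      by (auto simp: walk_hedges_def elim: set_hedge_list_nthE)
    note d = hedge_list_distinctD[OF dist _ i(1)]
    from i(2) show thesis
    proof
      assume "e = fst (ws ! i)"
      then show thesis by (intro that[of "- S i"]) (metis d hedge_list_distinctD(3)[OF dist i(1)] add.left_inverse)+
    next
      assume "e = snd (ws ! i)"
      then show thesis by (intro that[of "- S (Suc i)"]) (metis d add.left_inverse)+
    qed
  next
    case False
    then have "i < ?n \<Longrightarrow> e \<noteq> fst (ws ! i) \<and> e \<noteq> snd (ws ! i)" for i
      by (auto simp: walk_hedges_def set_hedge_list)
    then show thesis by (intro that) auto
  qed
  \<comment> \<open>A sum of indicators spares inverting the list: by distinctness only one visit
    contributes at a half-edge of the circuit.\<close>
  define y where "y h = (\<Sum>k<?n. (if snd (ws ! k) = h then K + S (Suc k) else 0)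
      - (if fst (ws ! k) = h then K + S k else 0))" for h
  have ys: "y (snd (ws ! i)) = K + S (Suc i)" and yf: "y (fst (ws ! i)) = - (K + S i)" if i: "i < ?n" for i
  proof -
    have "y (snd (ws ! i)) = (\<Sum>k<?n. if k = i then K + S (Suc k) else 0)"
      unfolding y_def using hedge_list_distinctD[OF dist _ i] hedge_list_distinctD[OF dist i]
      by (intro sum.cong) auto
    then show "y (snd (ws ! i)) = K + S (Suc i)" using i by simp
    have "y (fst (ws ! i)) = (\<Sum>k<?n. if k = i then - (K + S k) else 0)"
      unfolding y_def using hedge_list_distinctD[OF dist _ i] hedge_list_distinctD[OF dist i]
      by (intro sum.cong) auto
    then show "y (fst (ws ! i)) = - (K + S i)" using i by simp
  qed
  show ?thesis
  proof (intro exI[of _ y] conjI allI impI)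
    show "y (fst (ws ! i)) + y (snd (ws ! i)) = g (ws ! i)" if "i < ?n" for i
      using ys[OF that] yf[OF that] by (simp add: S_def)
    show "y (snd (ws ! i)) + y (fst (ws ! ((i + 1) mod ?n))) = 0" if i: "i < ?n" for i
    proof -
      \<comment> \<open>At the wrap-around this reads \<open>S 0 = S ?n\<close>, which is the
        vanishing of the total.\<close>
      have "S ((i + 1) mod ?n) = S (Suc i)"
        using i g0 by (cases "Suc i = ?n") (auto simp: S_def)
      moreover have "(i + 1) mod ?n < ?n" using i by (intro mod_less_divisor) linarith
      ultimately show ?thesis using ys[OF i] yf[of "(i + 1) mod ?n"] by simp
    qed
    show "y e = 0" if e: "e \<in> walk_hedges ws"
    proof -
      obtain i where i: "i < ?n" "e = fst (ws ! i) \<or> e = snd (ws ! i)"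
        using e by (auto simp: walk_hedges_def elim: set_hedge_list_nthE)
      then show ?thesis using K[OF i(1)] ys[OF i(1)] yf[OF i(1)] by (metis neg_0_equal_iff_equal)
    qed
  qed
qed

lemma mod_add_eq_imp_eq:
  assumes "(i + k) mod n = (i + l) mod n" "i < n" "k < n" "l < (n::nat)"
  shows "k = l"
proof -
  have "(i + m) mod n = (if i + m < n then i + m else i + m - n)" if "m < n" for m
    using that assms(2) by (simp add: le_mod_geq)
  then show ?thesis using assms by (auto split: if_splits)
qed

text \<open>\<open>d\<close> counts the steps forward from \<open>i\<close> to \<open>j\<close>, and
  \<open>n - d\<close> those onward from \<open>j\<close> to \<open>i\<close>. The last two
  equations evaluate the \<open>take\<close> lengths in \<open>seg ws i j\<close> and
  \<open>seg ws j i\<close>.\<close>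

lemma cyclic_distance:
  assumes "i < n" "j < n" "i \<noteq> (j::nat)"
  obtains d where "0 < d" "d < n" "j = (i + d) mod n" "i = (j + (n - d)) mod n"
    "(j + n - i - 1) mod n = d - 1" "(i + n - j - 1) mod n = n - d - 1"
proof (cases "i < j")
  case True
  have eq: "j + n - i - 1 = (j - i - 1) + n" using True by simp
  have "(j + n - i - 1) mod n = j - i - 1" unfolding eq mod_add_self2 using assms True by (intro mod_less) linarith
  moreover have "j + (n - (j - i)) = i + n" using True assms by simp
  ultimately show thesis using True assms by (intro that[of "j - i"]) auto
next
  case False
  then have "j < i" using assms by simp
  have eq: "i + n - j - 1 = (i - j - 1) + n" using \<open>j < i\<close> by simp
  have "(i + n - j - 1) mod n = i - j - 1" unfolding eq mod_add_self2 using assms \<open>j < i\<close> by (intro mod_less) linarith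
  moreover have "i + (n - (i - j)) = j + n" using \<open>j < i\<close> assms by simp
  moreover have "n - (n - (i - j)) = i - j" using assms \<open>j < i\<close> by simp
  ultimately show thesis using \<open>j < i\<close> assms by (intro that[of "n - (i - j)"]) auto
qed

subsection \<open>Circuits induced by an Euler system\<close>

text \<open>The closing transition stands at position 0, with the exit of visit \<open>i\<close> and
  the entry of visit \<open>j\<close>. Exits and entries therefore follow \<open>ws\<close> all the
  way round, but whole pairs agree only from position 1 on.\<close>

lemma seg_nth:
  assumes "i < length ws" "0 < d" "d < length ws" "j = (i + d) mod length ws"
    "(j + length ws - i - 1) mod length ws = d - 1"
  shows "length (seg ws i j) = d"
    "k < d \<Longrightarrow> snd (seg ws i j ! k) = snd (ws ! ((i + k) mod length ws))"
    "k < d \<Longrightarrow> fst (seg ws i j ! ((k + 1) mod d)) = fst (ws ! ((i + k + 1) mod length ws))"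
    "0 < k \<Longrightarrow> k < d \<Longrightarrow> seg ws i j ! k = ws ! ((i + k) mod length ws)"
proof -
  show len: "length (seg ws i j) = d" using assms by (simp add: seg_def)
  have nth: "seg ws i j ! k = ws ! ((i + k) mod length ws)" if "0 < k" "k < d" for k
    using that assms by (cases k) (simp_all add: seg_def nth_rotate del: rotate_Suc)
  show "0 < k \<Longrightarrow> k < d \<Longrightarrow> seg ws i j ! k = ws ! ((i + k) mod length ws)" by (rule nth)
  show "k < d \<Longrightarrow> snd (seg ws i j ! k) = snd (ws ! ((i + k) mod length ws))"
    using nth assms(1) by (cases "k = 0") (simp_all add: seg_def)
  show "fst (seg ws i j ! ((k + 1) mod d)) = fst (ws ! ((i + k + 1) mod length ws))" if "k < d"
  \<comment> \<open>The last edge of the segment leads to the entry of visit \<open>j\<close>, which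
    is the entry of the closing transition.\<close>
  proof (cases "k + 1 = d")
    case True
    then have "fst (seg ws i j ! ((k + 1) mod d)) = fst (ws ! ((i + (k + 1)) mod length ws))"
      using assms(4) by (simp add: seg_def)
    then show ?thesis by (simp only: add.assoc)
  next
    case False
    then show ?thesis using nth[of "k + 1"] that by simp
  qed
qed

lemma traversals_seg:
  assumes "i < length ws" "0 < d" "d < length ws" "j = (i + d) mod length ws"
    "(j + length ws - i - 1) mod length ws = d - 1"
  shows "traversals (seg ws i j) =
    map (\<lambda>k. (snd (ws ! ((i + k) mod length ws)), fst (ws ! ((i + k + 1) mod length ws)))) [0..<d]"
  unfolding traversals_def seg_nth(1)[OF assms]
  by (intro map_cong refl) (use seg_nth(2,3)[OF assms] in auto)

lemma seg_closed_walk: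
  assumes circ: "oriented_circuit G ws"
    and ij: "i < length ws" "j < length ws" "i \<noteq> j"
    and inc: "inc G (fst (ws ! i)) = inc G (fst (ws ! j))"
  shows "closed_walk G (seg ws i j)"
proof -
  obtain d where d: "0 < d" "d < length ws" "j = (i + d) mod length ws"
    "(j + length ws - i - 1) mod length ws = d - 1"
    using cyclic_distance[OF ij] .
  note nth = seg_nth[OF ij(1) d]
  have ws: "closed_walk G ws" and dist: "distinct (hedge_list ws)"
    using circ by (auto simp: oriented_circuit_def)
  have lt: "k mod length ws < length ws" for k
    using ij(1) by (intro mod_less_divisor) linarith
  have st: "fst (seg ws i j ! k) \<in> hedges G \<and> snd (seg ws i j ! k) \<in> hedges G
      \<and> fst (seg ws i j ! k) \<noteq> snd (seg ws i j ! k)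
      \<and> inc G (fst (seg ws i j ! k)) = inc G (snd (seg ws i j ! k))" if "k < d" for k
  proof (cases "k = 0")
    case True
    then show ?thesis
      using closed_walkD[OF ws ij(1)] closed_walkD[OF ws ij(2)] inc
        hedge_list_distinctD(3)[OF dist ij(2,1)] by (simp add: seg_def)
  next
    case False
    then show ?thesis
      using nth(4)[of k] that closed_walkD[OF ws lt[of "i + k"]] by simp
  qed
  show ?thesis
    unfolding closed_walk_def nth(1)
  proof (intro allI impI)
    fix k assume k: "k < d"
    show "fst (seg ws i j ! k) \<in> hedges G \<and> snd (seg ws i j ! k) \<in> hedges G
      \<and> fst (seg ws i j ! k) \<noteq> snd (seg ws i j ! k)
      \<and> inc G (fst (seg ws i j ! k)) = inc G (snd (seg ws i j ! k))
      \<and> {snd (seg ws i j ! k), fst (seg ws i j ! ((k + 1) mod d))} \<in> edges G"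
      unfolding nth(2)[OF k] nth(3)[OF k]
      using st[OF k] closed_walkD(5)[OF ws lt[of "i + k"]] nth(2)[OF k]
      by (simp add: mod_simps)
  qed
qed

text \<open>The exit of visit \<open>m\<close> counts the segment edges leaving that visit, and its
  entry counts, negatively, those arriving. The difference telescopes along the segment to its two
  ends.\<close>

lemma flow_seg:
  assumes circ: "oriented_circuit G ws"
    and ij: "i < length ws" "j < length ws" "i \<noteq> j" and m: "m < length ws"
  shows "flow (seg ws i j) (fst (ws ! m)) + flow (seg ws i j) (snd (ws ! m)) = of_bool (m = i) - of_bool (m = j)"
proof -
  obtain d where d: "0 < d" "d < length ws" "j = (i + d) mod length ws"
    "(j + length ws - i - 1) mod length ws = d - 1"
    using cyclic_distance[OF ij] .
  have dist: "distinct (hedge_list ws)" using circ by (auto simp: oriented_circuit_def)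
  have lt: "k mod length ws < length ws" for k
    using ij(1) by (intro mod_less_divisor) linarith
  \<comment> \<open>\<open>f k\<close> tells whether the visit \<open>k\<close> places after
    \<open>i\<close> is visit \<open>m\<close>.\<close>
  define f where "f k = (of_bool ((i + k) mod length ws = m) :: int)" for k
  have flow: "flow (seg ws i j) h = (\<Sum>k<d. of_bool (snd (ws ! ((i + k) mod length ws)) = h)
      - of_bool (fst (ws ! ((i + k + 1) mod length ws)) = h))" for h
    unfolding flow_traversals sum_list_conv_sum_nth traversals_seg[OF ij(1) d]
    by (intro sum.cong) simp_all
  have "flow (seg ws i j) (fst (ws ! m)) = (\<Sum>k<d. - f (k + 1))"
    unfolding flow f_def
    by (intro sum.cong) (simp_all add: hedge_list_distinctD[OF dist m lt] hedge_list_distinctD[OF dist lt m] del: mod_Suc)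
  moreover have "flow (seg ws i j) (snd (ws ! m)) = (\<Sum>k<d. f k)"
    unfolding flow f_def
    by (intro sum.cong) (simp_all add: hedge_list_distinctD[OF dist m lt] hedge_list_distinctD[OF dist lt m] del: mod_Suc)
  ultimately have "flow (seg ws i j) (fst (ws ! m)) + flow (seg ws i j) (snd (ws ! m)) = (\<Sum>k<d. f k - f (Suc k))"
    by (simp add: sum_subtractf sum_negf)
  also have "\<dots> = f 0 - f d" by (rule sum_lessThan_telescope')
  also have "\<dots> = of_bool (m = i) - of_bool (m = j)"
    using ij(1) d(3) by (auto simp: f_def)
  finally show ?thesis .
qed

lemma walk_hedges_seg:
  assumes "i < length ws" "j < length ws"
  shows "walk_hedges (seg ws i j) \<subseteq> walk_hedges ws"
proof -
  have take: "set (take k (rotate l ws)) \<subseteq> set ws" for k l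
    using set_take_subset[of k "rotate l ws"] by simp
  have *: "fst p \<in> walk_hedges ws" "snd p \<in> walk_hedges ws" if "p \<in> set ws" for p
    using that by (auto simp: walk_hedges_def set_hedge_list)
  have "fst p \<in> walk_hedges ws \<and> snd p \<in> walk_hedges ws" if "p \<in> set (seg ws i j)" for p
  proof -
    have "p = (fst (ws ! j), snd (ws ! i)) \<or> p \<in> set ws"
      using that take unfolding seg_def by (metis set_ConsD subsetD)
    then show ?thesis
      using *[of p] *[OF nth_mem[OF assms(1)]] *[OF nth_mem[OF assms(2)]] by fastforce
  qed
  then show ?thesis
    unfolding walk_hedges_def[of "seg ws i j"] set_hedge_list by blast
qed

text \<open>Each visit uses up two half-edges at \<open>v\<close>, all of them different, so four
  half-edges make two visits.\<close>

lemma euler_vertex_visits: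
  assumes reg: "four_regular G" and circ: "oriented_circuit G ws"
    and v: "v \<in> verts G" and sub: "hedges_at G v \<subseteq> walk_hedges ws"
  obtains i j where "i < length ws" "j < length ws" "i \<noteq> j"
    "{k. k < length ws \<and> inc G (fst (ws ! k)) = v} = {i, j}"
    "hedges_at G v = {fst (ws ! i), snd (ws ! i), fst (ws ! j), snd (ws ! j)}"
proof -
  have ws: "closed_walk G ws" and dist: "distinct (hedge_list ws)"
    using circ by (auto simp: oriented_circuit_def)
  define A where "A = {k. k < length ws \<and> inc G (fst (ws ! k)) = v}"
  have fin: "finite A" by (simp add: A_def)
  have at: "hedges_at G v = (\<lambda>k. fst (ws ! k)) ` A \<union> (\<lambda>k. snd (ws ! k)) ` A"
  proof
    show "hedges_at G v \<subseteq> (\<lambda>k. fst (ws ! k)) ` A \<union> (\<lambda>k. snd (ws ! k)) ` A"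
    proof
      fix h assume h: "h \<in> hedges_at G v"
      then obtain k where k: "k < length ws" "h = fst (ws ! k) \<or> h = snd (ws ! k)"
        using sub by (auto simp: walk_hedges_def elim: set_hedge_list_nthE)
      then have "k \<in> A" using h closed_walkD(4)[OF ws k(1)] by (auto simp: A_def hedges_at_def)
      then show "h \<in> (\<lambda>k. fst (ws ! k)) ` A \<union> (\<lambda>k. snd (ws ! k)) ` A" using k(2) by blast
    qed
    show "(\<lambda>k. fst (ws ! k)) ` A \<union> (\<lambda>k. snd (ws ! k)) ` A \<subseteq> hedges_at G v"
      using closed_walkD[OF ws] by (auto simp: A_def hedges_at_def)
  qed
  have "card (hedges_at G v) = card A + card A"
    unfolding at using fin hedge_list_distinctD[OF dist]
    by (subst card_Un_disjoint) (auto simp: A_def inj_on_def card_image)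
  then have "card A = 2" using reg v by (simp add: four_regular_def)
  then obtain i j where ij: "A = {i, j}" "i \<noteq> j" by (auto simp: card_2_iff)
  then have "i \<in> A" "j \<in> A" by simp_all
  then show thesis
    using ij at by (intro that[of i j]) (auto simp: A_def)
qed

lemma euler_circuit_at:
  assumes "wf_graph G" "euler_system G C" "v \<in> verts G"
  obtains ws where "ws \<in> C" "oriented_circuit G ws" "walk_hedges ws = comp_hedges G (component_of G v)"
    "hedges_at G v \<subseteq> walk_hedges ws"
proof -
  have "\<exists>!ws. ws \<in> C \<and> walk_hedges ws = comp_hedges G (component_of G v)"
    using assms(2) component_of_in[OF assms(3)] by (simp add: euler_system_def)
  then obtain ws where ws: "ws \<in> C" "walk_hedges ws = comp_hedges G (component_of G v)" by blast
  moreover have "oriented_circuit G ws" using assms(2) ws(1) by (simp add: euler_system_def)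
  moreover have "hedges_at G v \<subseteq> walk_hedges ws"
    using mem_component_of[OF assms(3)] by (auto simp: ws(2) comp_hedges_def hedges_at_def)
  ultimately show thesis using that by blast
qed

text \<open>Shows that the choice in \<open>induced\<close> is possible. The two segments between
  the visits of \<open>v\<close> share the traversals of the Euler circuit among them, so the only
  base edge of the component is missed by one of them.\<close>

lemma induced_segment:
  assumes wf: "wf_graph G" and reg: "four_regular G" and based: "based G Eb"
    and C: "euler_system G C" and v: "v \<in> verts G"
  obtains ws i j where "ws \<in> C" "i < length ws" "j < length ws" "i \<noteq> j"
    "inc G (fst (ws ! i)) = v" "inc G (fst (ws ! j)) = v"
    "induced G Eb C v = seg ws i j"
    "\<forall>t\<in>set (traversals (seg ws i j)). {fst t, snd t} \<notin> Eb"
proof -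
  obtain ws where ws: "ws \<in> C" "oriented_circuit G ws" "hedges_at G v \<subseteq> walk_hedges ws"
    using euler_circuit_at[OF wf C v] .
  have cw: "closed_walk G ws" and dist: "distinct (hedge_list ws)"
    using ws(2) by (auto simp: oriented_circuit_def)
  obtain i j where ij: "i < length ws" "j < length ws" "i \<noteq> j"
    "{k. k < length ws \<and> inc G (fst (ws ! k)) = v} = {i, j}"
    using euler_vertex_visits[OF reg ws(2) v ws(3)] .
  have inc: "inc G (fst (ws ! i)) = v" "inc G (fst (ws ! j)) = v" using ij(4) by blast+
  obtain d where d: "0 < d" "d < length ws" "j = (i + d) mod length ws" "i = (j + (length ws - d)) mod length ws"
    "(j + length ws - i - 1) mod length ws = d - 1" "(i + length ws - j - 1) mod length ws = length ws - d - 1"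
    using cyclic_distance[OF ij(1-3)] .
  have lt: "k mod length ws < length ws" for k
    using ij(1) by (intro mod_less_divisor) linarith
  let ?tr = "\<lambda>k. (snd (ws ! (k mod length ws)), fst (ws ! ((k + 1) mod length ws)))"
  have t1: "set (traversals (seg ws i j)) = (\<lambda>k. ?tr (i + k)) ` {..<d}"
    by (auto simp: traversals_seg[OF ij(1) d(1,2,3,5)])
  have "0 < length ws - d" "length ws - d < length ws" using d by auto
  note t2' = traversals_seg[OF ij(2) this d(4,6)]
  have t2: "set (traversals (seg ws j i)) = (\<lambda>k. ?tr (j + k)) ` {..<length ws - d}"
    by (auto simp: t2')
  have ex: "(\<forall>t\<in>set (traversals (seg ws i j)). {fst t, snd t} \<notin> Eb) \<or>
      (\<forall>t\<in>set (traversals (seg ws j i)). {fst t, snd t} \<notin> Eb)"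
  proof (rule ccontr)
    assume "\<not> ?thesis"
    then obtain k l where k: "k < d" "{fst (?tr (i + k)), snd (?tr (i + k))} \<in> Eb"
      and l: "l < length ws - d" "{fst (?tr (j + l)), snd (?tr (j + l))} \<in> Eb"
      unfolding t1 t2 by blast
    let ?p = "(i + k) mod length ws" and ?q = "(j + l) mod length ws"
    have "snd (ws ! ?p) \<in> walk_hedges ws" "snd (ws ! ?q) \<in> walk_hedges ws"
      unfolding walk_hedges_def set_hedge_list using lt by (meson UnI2 imageI nth_mem)+
    then have "component_of G (inc G (snd (ws ! ?p))) = component_of G (inc G (snd (ws ! ?q)))"
      by (rule closed_walk_component[OF wf cw])
    then have "{fst (?tr (i + k)), snd (?tr (i + k))} = {fst (?tr (j + l)), snd (?tr (j + l))}"
      by (intro based_unique[OF wf based k(2) l(2), of "snd (ws ! ?p)" "snd (ws ! ?q)"]) simp_all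
    \<comment> \<open>The two traversals of the common edge cannot run in opposite directions, since
      an exit would then also be an entry.\<close>
    then have "snd (ws ! ?p) = snd (ws ! ?q)"
      using hedge_list_distinctD(4)[OF dist lt[of "j + l + 1"] lt[of "i + k"]] by (auto simp: doubleton_eq_iff)
    then have "?p = ?q" using hedge_list_distinctD(2)[OF dist lt lt] by blast
    then have "(i + k) mod length ws = (i + (d + l)) mod length ws"
      by (simp add: d(3) mod_simps add.assoc)
    \<comment> \<open>Both offsets from visit \<open>i\<close> stay within one turn, so equal
      positions mean equal offsets, contrary to \<open>k < d\<close>.\<close>
    moreover have "k < length ws" "d + l < length ws" using k(1) l(1) d(2) by linarith+
    ultimately have "k = d + l" by (rule mod_add_eq_imp_eq[OF _ ij(1)])
    then show False using k(1) by simp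
  qed
  let ?P = "\<lambda>w. \<exists>ws\<in>C. \<exists>i j. i < length ws \<and> j < length ws \<and> i \<noteq> j
       \<and> inc G (fst (ws ! i)) = v \<and> inc G (fst (ws ! j)) = v
       \<and> w = seg ws i j \<and> (\<forall>t\<in>set (traversals w). {fst t, snd t} \<notin> Eb)"
  from ex have "?P (seg ws i j) \<or> ?P (seg ws j i)"
  proof
    assume "\<forall>t\<in>set (traversals (seg ws i j)). {fst t, snd t} \<notin> Eb"
    then show ?thesis using ws(1) ij(1-3) inc by blast
  next
    assume "\<forall>t\<in>set (traversals (seg ws j i)). {fst t, snd t} \<notin> Eb"
    then show ?thesis using ws(1) ij(1-3) inc by blast
  qed
  then have "\<exists>w. ?P w" by (rule disjE) (erule exI[of ?P])+
  \<comment> \<open>\<open>SOME\<close> may return a segment other than the one just found; only the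
    defining property is passed on.\<close>
  then have "?P (induced G Eb C v)"
    unfolding induced_def by (rule someI_ex)
  then show thesis
  proof (elim bexE exE conjE)
    fix ws' i' j'
    assume *: "ws' \<in> C" "i' < length ws'" "j' < length ws'" "i' \<noteq> j'"
      "inc G (fst (ws' ! i')) = v" "inc G (fst (ws' ! j')) = v"
    assume eq: "induced G Eb C v = seg ws' i' j'"
      and "\<forall>t\<in>set (traversals (induced G Eb C v)). {fst t, snd t} \<notin> Eb"
    then have "\<forall>t\<in>set (traversals (seg ws' i' j')). {fst t, snd t} \<notin> Eb" by simp
    then show thesis by (rule that[OF * eq])
  qed
qed

subsection \<open>Divergence on half-edges\<close>

definition edge_at :: "('v, 'h) graph \<Rightarrow> 'h \<Rightarrow> 'h set" where
  "edge_at G h = (THE e. e \<in> edges G \<and> h \<in> e)"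

text \<open>The value of the edge at \<open>h\<close>, signed as in the incidence matrix: plus at
  the head, minus at the tail.\<close>

definition outflow :: "('v, 'h) graph \<Rightarrow> ('h set \<Rightarrow> 'h) \<Rightarrow> ('h set \<Rightarrow> 'a::comm_ring_1) \<Rightarrow> 'h \<Rightarrow> 'a" where
  "outflow G D x h = (if D (edge_at G h) = h then - x (edge_at G h) else x (edge_at G h))"

lemma edge_at_eq:
  assumes "wf_graph G" "e \<in> edges G" "h \<in> e"
  shows "edge_at G h = e"
  unfolding edge_at_def
proof (rule the_equality)
  show "e \<in> edges G \<and> h \<in> e" using assms(2,3) by simp
  show "e' = e" if "e' \<in> edges G \<and> h \<in> e'" for e'
    using that assms by (intro edge_unique[OF assms(1), of e' e h]) simp_all
qed

lemma tail_head:
  assumes "wf_graph G" "orientation G D" "e \<in> edges G"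
  shows "e = {D e, head D e}" "D e \<noteq> head D e"
proof -
  have "D e \<in> e" using assms(2,3) by (simp add: orientation_def)
  then obtain h where h: "e = {D e, h}" "D e \<noteq> h" using edgeE[OF assms(1,3)] by blast
  then have "e - {D e} = {h}" by blast
  then have "head D e = h" by (simp add: head_def)
  then show "e = {D e, head D e}" "D e \<noteq> head D e" using h by simp_all
qed

lemma outflow_tail_head:
  assumes "wf_graph G" "orientation G D" "e \<in> edges G"
  shows "outflow G D x (D e) = - x e" "outflow G D x (head D e) = x e"
proof -
  note th = tail_head[OF assms]
  have "edge_at G (D e) = e" "edge_at G (head D e) = e"
    using th(1) by (intro edge_at_eq[OF assms(1,3)]; blast)+
  then show "outflow G D x (D e) = - x e" "outflow G D x (head D e) = x e"
    using th(2) by (simp_all add: outflow_def)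
qed

lemma finite_edges:
  assumes "wf_graph G"
  shows "finite (edges G)"
proof (rule finite_subset)
  show "edges G \<subseteq> Pow (hedges G)" "finite (Pow (hedges G))"
    using assms by (auto simp: wf_graph_def)
qed

lemma Union_edges: "wf_graph G \<Longrightarrow> \<Union>(edges G) = hedges G"
  unfolding wf_graph_def by fast

text \<open>Group the half-edges by edge. A loop contributes at both of its ends and cancels, in
  agreement with \<open>incid\<close>. In the touch-graph this turns divergence at a circuit into a
  sum over its single transitions.\<close>

lemma divergence_eq_sum_outflow:
  assumes wf: "wf_graph G" and D: "orientation G D"
  shows "(\<Sum>e\<in>edges G. of_int (incid G D v e) * x e) = (\<Sum>h\<in>hedges_at G v. outflow G D x h)"
proof -
  let ?f = "\<lambda>h. of_bool (inc G h = v) * outflow G D x h"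
  have fin: "finite (hedges G)" using wf by (simp add: wf_graph_def)
  have "(\<Sum>h\<in>hedges_at G v. outflow G D x h) = (\<Sum>h\<in>hedges G. ?f h)"
    using fin unfolding hedges_at_def by (intro sum.mono_neutral_cong_left) auto
  also have "\<dots> = (\<Sum>h\<in>\<Union>(edges G). ?f h)" by (simp add: Union_edges[OF wf])
  also have "\<dots> = (\<Sum>e\<in>edges G. \<Sum>h\<in>e. ?f h)"
  proof (rule sum.Union_disjoint[unfolded comp_def])
    show "\<forall>e\<in>edges G. finite e"
      using fin edge_subset_hedges[OF wf] by (meson finite_subset subsetI)
    show "\<forall>e\<in>edges G. \<forall>e'\<in>edges G. e \<noteq> e' \<longrightarrow> e \<inter> e' = {}"
      using edge_unique[OF wf] by blast
  qed
  also have "\<dots> = (\<Sum>e\<in>edges G. of_int (incid G D v e) * x e)"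
  proof (rule sum.cong[OF refl])
    fix e assume e: "e \<in> edges G"
    note th = tail_head[OF wf D e] outflow_tail_head[OF wf D e, of x]
    have "(\<Sum>h\<in>e. ?f h) = (\<Sum>h\<in>{D e, head D e}. ?f h)" using th(1) by simp
    also have "\<dots> = of_int (incid G D v e) * x e"
      using th(2-) by (simp add: incid_def)
    finally show "(\<Sum>h\<in>e. ?f h) = of_int (incid G D v e) * x e" .
  qed
  finally show ?thesis by simp
qed

subsection \<open>The touch-graph\<close>

text \<open>Rotation keeps the set of pairs and reversal only swaps their components, so every
  representing list has the same unordered pairs.\<close>

lemma strans_circuit_of: "strans (circuit_of ws) = (\<lambda>(a, b). {a, b}) ` set ws"
proof -
  let ?p = "\<lambda>(a, b). {a, b}"
  have strans: "strans c = (\<Union>ws\<in>c. ?p ` set ws)" for c :: "('b \<times> 'b) list set"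
    unfolding strans_def by fast
  have "?p ` set (rev_walk ws) = ?p ` set ws"
    by (simp add: rev_walk_def image_image case_prod_beta insert_commute)
  then have eq: "?p ` set ws' = ?p ` set ws" if "ws' \<in> circuit_of ws" for ws'
  proof -
    have "set ws' = set ws \<or> set ws' = set (rev_walk ws)"
      using that unfolding circuit_of_def by auto
    then show ?thesis using \<open>?p ` set (rev_walk ws) = ?p ` set ws\<close> by (elim disjE) simp_all
  qed
  have "rotate 0 ws \<in> circuit_of ws" unfolding circuit_of_def by blast
  then have "circuit_of ws \<noteq> {}" by blast
  then show ?thesis unfolding strans by (intro SUP_eq_const eq)
qed

lemma Union_pairs: "\<Union>((\<lambda>(a, b). {a, b}) ` A) = fst ` A \<union> snd ` A"
  by force

locale partitioned_graph =
  fixes F :: "('v, 'h) graph" and P :: "('h \<times> 'h) list set set"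
  assumes wf: "wf_graph F" and reg: "four_regular F" and part: "circuit_partition F P"
begin

abbreviation ST :: "'h set set" where
  "ST \<equiv> \<Union>c\<in>P. strans c"

abbreviation T :: "(('h \<times> 'h) list set, 'h set) graph" where
  "T \<equiv> Tch F P"

abbreviation st :: "'h \<Rightarrow> 'h set" where
  "st \<equiv> st_of P"

text \<open>A chosen starting point and orientation, so that potentials can be built along a
  list.\<close>

definition rep :: "('h \<times> 'h) list set \<Rightarrow> ('h \<times> 'h) list" where
  "rep c = (SOME ws. oriented_circuit F ws \<and> c = circuit_of ws)"

lemma rep:
  assumes "c \<in> P"
  shows "closed_walk F (rep c)" "rep c \<noteq> []" "distinct (hedge_list (rep c))"
    "strans c = (\<lambda>(a, b). {a, b}) ` set (rep c)"
proof -
  have "\<exists>ws. oriented_circuit F ws \<and> c = circuit_of ws"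
    using part assms by (auto simp: circuit_partition_def is_circuit_def)
  from someI_ex[OF this] have *: "oriented_circuit F (rep c)" "c = circuit_of (rep c)"
    by (auto simp: rep_def)
  then show "closed_walk F (rep c)" "rep c \<noteq> []" "distinct (hedge_list (rep c))"
    by (auto simp: oriented_circuit_def)
  show "strans c = (\<lambda>(a, b). {a, b}) ` set (rep c)"
    by (subst *(2)) (rule strans_circuit_of)
qed

lemma strans_nth:
  assumes "c \<in> P"
  shows "strans c = (\<lambda>i. {fst (rep c ! i), snd (rep c ! i)}) ` {..<length (rep c)}"
proof -
  have "set (rep c) = (\<lambda>i. rep c ! i) ` {..<length (rep c)}"
    by (auto simp: set_conv_nth)
  then show ?thesis unfolding rep(4)[OF assms] by (simp add: image_image case_prod_beta)
qed

lemma Union_strans: "c \<in> P \<Longrightarrow> \<Union>(strans c) = walk_hedges (rep c)"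
  by (simp only: rep(4) Union_pairs walk_hedges_def set_hedge_list)

lemma ST_props:
  assumes "s \<in> ST"
  obtains a b where "s = {a, b}" "a \<noteq> b" "a \<in> hedges F" "b \<in> hedges F" "inc F a = inc F b"
proof -
  obtain c where c: "c \<in> P" "s \<in> strans c" using assms by blast
  then obtain i where i: "i < length (rep c)" "s = {fst (rep c ! i), snd (rep c ! i)}"
    using strans_nth by blast
  then show thesis using closed_walkD[OF rep(1)[OF c(1)] i(1)] that by blast
qed

lemma ST_subset: "s \<in> ST \<Longrightarrow> h \<in> s \<Longrightarrow> h \<in> hedges F"
  by (erule ST_props) blast

lemma ST_inc: "s \<in> ST \<Longrightarrow> h \<in> s \<Longrightarrow> h' \<in> s \<Longrightarrow> inc F h = inc F h'"
  by (erule ST_props) auto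

lemma ST_card: "s \<in> ST \<Longrightarrow> card s = 2"
  by (erule ST_props) simp

lemma strans_unique:
  assumes "c \<in> P" "s \<in> strans c" "h \<in> s" "c' \<in> P" "s' \<in> strans c'" "h \<in> s'"
  shows "c = c' \<and> s = s'"
proof -
  have "s \<in> ST" using assms(1,2) by (rule UN_I)
  then have "h \<in> hedges F" using assms(3) by (rule ST_subset)
  then have "\<exists>!cs. fst cs \<in> P \<and> snd cs \<in> strans (fst cs) \<and> h \<in> snd cs"
    using part by (simp add: circuit_partition_def)
  then obtain cs where uniq: "\<forall>y. fst y \<in> P \<and> snd y \<in> strans (fst y) \<and> h \<in> snd y \<longrightarrow> y = cs"
    by (rule ex1E)
  have "(c, s) = cs" using uniq[rule_format, of "(c, s)"] assms by simp
  moreover have "(c', s') = cs" using uniq[rule_format, of "(c', s')"] assms by simp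
  ultimately show ?thesis by auto
qed

lemma st_eq:
  assumes "s \<in> ST" "h \<in> s"
  shows "st h = s"
  unfolding st_of_def
proof (rule the_equality)
  show "s \<in> ST \<and> h \<in> s" using assms by simp
  fix s' assume "s' \<in> ST \<and> h \<in> s'"
  then obtain c' where "c' \<in> P" "s' \<in> strans c'" "h \<in> s'" by blast
  moreover obtain c where "c \<in> P" "s \<in> strans c" using assms(1) by blast
  ultimately show "s' = s" using strans_unique[of c' s' h c s] assms(2) by simp
qed

lemma st_in:
  assumes "h \<in> hedges F"
  shows "st h \<in> ST" "h \<in> st h"
proof -
  have "\<exists>!cs. fst cs \<in> P \<and> snd cs \<in> strans (fst cs) \<and> h \<in> snd cs"
    using part assms by (simp add: circuit_partition_def)
  then obtain cs where "fst cs \<in> P" "snd cs \<in> strans (fst cs)" and h: "h \<in> snd cs" by (elim ex1E conjE)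
  then have s: "snd cs \<in> ST" by blast
  show "st h \<in> ST" "h \<in> st h" using s h by (simp_all only: st_eq[OF s h])
qed

lemma Tch_simps: "verts T = P" "hedges T = ST" "edges T = tau F P"
  by (simp_all add: Tch_def)

lemma inc_Tch:
  assumes "c \<in> P" "s \<in> strans c"
  shows "inc T s = c"
proof -
  have "s \<in> ST" using assms by (rule UN_I)
  then have "s \<noteq> {}" using ST_card[of s] by auto
  then obtain h where h: "h \<in> s" by blast
  have "inc T s = (THE c. c \<in> P \<and> s \<in> strans c)" by (simp add: Tch_def)
  also have "\<dots> = c"
  proof (rule the_equality)
    show "c \<in> P \<and> s \<in> strans c" using assms by simp
    show "c' = c" if "c' \<in> P \<and> s \<in> strans c'" for c'
      using that strans_unique[of c' s h c s] assms h by simp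
  qed
  finally show ?thesis .
qed

lemma inc_Tch_in:
  assumes "s \<in> ST"
  shows "inc T s \<in> P" "s \<in> strans (inc T s)"
proof -
  obtain c where c: "c \<in> P" "s \<in> strans c" using assms by blast
  then show "inc T s \<in> P" "s \<in> strans (inc T s)" by (simp_all only: inc_Tch[OF c])
qed

lemma hedges_at_Tch:
  assumes "c \<in> P"
  shows "hedges_at T c = strans c"
proof
  show "hedges_at T c \<subseteq> strans c"
    using inc_Tch_in(2) by (auto simp: hedges_at_def Tch_simps)
  show "strans c \<subseteq> hedges_at T c"
    using inc_Tch[OF assms] assms by (auto simp: hedges_at_def Tch_simps)
qed

text \<open>A circuit of \<open>P\<close> through \<open>a\<close> traverses the whole edge, so it
  also contains \<open>b\<close>. This is what makes projected walks link up and lets potentials be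
  glued.\<close>

lemma inc_Tch_edge:
  assumes "{a, b} \<in> edges F"
  shows "inc T (st a) = inc T (st b)"
proof -
  let ?c = "inc T (st a)"
  have a: "a \<in> hedges F" using edge_pairD[OF wf assms] by simp
  note c = inc_Tch_in[OF st_in(1)[OF a]]
  have "a \<in> walk_hedges (rep ?c)" using Union_strans[OF c(1)] c(2) st_in(2)[OF a] by blast
  then have "b \<in> walk_hedges (rep ?c)" by (rule closed_walk_edge_closed'[OF wf rep(1)[OF c(1)] _ assms])
  then obtain s where s: "s \<in> strans ?c" "b \<in> s" using Union_strans[OF c(1)] by blast
  then have "st b = s" using c(1) by (intro st_eq) blast
  then show ?thesis using inc_Tch[OF c(1) s(1)] by simp
qed

text \<open>The transition that \<open>P\<close> follows at \<open>v\<close>, which is the edge of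
  the touch-graph belonging to \<open>v\<close>.\<close>

definition tr :: "'v \<Rightarrow> 'h set set" where
  "tr v = st ` hedges_at F v"

lemma mem_tr_iff:
  assumes "s \<in> ST" "h \<in> s"
  shows "s \<in> tr v \<longleftrightarrow> inc F h = v"
proof
  assume "s \<in> tr v"
  then obtain k where k: "k \<in> hedges F" "inc F k = v" "s = st k" by (auto simp: tr_def hedges_at_def)
  then have "k \<in> s" using st_in(2)[of k] by simp
  then show "inc F h = v" using ST_inc[OF assms] k(2) by simp
next
  assume "inc F h = v"
  then have "h \<in> hedges_at F v" using ST_subset[OF assms] by (simp add: hedges_at_def)
  then show "s \<in> tr v" using st_eq[OF assms] by (auto simp: tr_def)
qed

lemma st_subset_at: "h \<in> hedges_at F v \<Longrightarrow> st h \<subseteq> hedges_at F v"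
  using st_in ST_inc ST_subset unfolding hedges_at_def by blast

lemma st_disjoint:
  assumes "h \<in> hedges F" "h' \<in> hedges F" "st h \<noteq> st h'"
  shows "st h \<inter> st h' = {}"
  using assms st_in(1) st_eq by (metis disjoint_iff)

text \<open>Two different single transitions of \<open>P\<close> are disjoint, so they have four
  half-edges together and exhaust those at \<open>v\<close>.\<close>

lemma st_pair:
  assumes v: "v \<in> verts F" and h: "h \<in> hedges_at F v" "h' \<in> hedges_at F v" "st h \<noteq> st h'"
  shows "tr v = {st h, st h'}" "st h \<union> st h' = hedges_at F v" "tr v \<in> tau F P"
proof -
  have hF: "h \<in> hedges F" "h' \<in> hedges F" using h by (auto simp: hedges_at_def)
  have card4: "card (hedges_at F v) = 4" using reg v by (simp add: four_regular_def)
  have fin: "finite (hedges_at F v)" using card4 by (intro card_ge_0_finite) simp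
  have dis: "st h \<inter> st h' = {}" by (rule st_disjoint[OF hF h(3)])
  have sub: "st h \<subseteq> hedges_at F v" "st h' \<subseteq> hedges_at F v" using st_subset_at h by auto
  have "card (st h \<union> st h') = card (st h) + card (st h')"
    using dis sub fin by (intro card_Un_disjoint) (auto intro: finite_subset)
  then have "card (st h \<union> st h') = card (hedges_at F v)"
    using ST_card[OF st_in(1)[OF hF(1)]] ST_card[OF st_in(1)[OF hF(2)]] card4 by simp
  then show un: "st h \<union> st h' = hedges_at F v"
    using fin sub by (intro card_subset_eq) auto
  show tr: "tr v = {st h, st h'}"
  proof
    show "tr v \<subseteq> {st h, st h'}"
    proof
      fix s assume "s \<in> tr v"
      then obtain k where "k \<in> hedges_at F v" "s = st k" by (auto simp: tr_def)
      then show "s \<in> {st h, st h'}" using un st_eq[OF st_in(1)[OF hF(1)]] st_eq[OF st_in(1)[OF hF(2)]] by blast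
    qed
    show "{st h, st h'} \<subseteq> tr v" using h by (auto simp: tr_def)
  qed
  have "transition F v (tr v)"
    unfolding transition_def single_transition_def tr
    using ST_card[OF st_in(1)[OF hF(1)]] ST_card[OF st_in(1)[OF hF(2)]] dis sub un by blast
  then show "tr v \<in> tau F P" using v st_in(1) hF by (auto simp: tau_def tr)
qed

lemma tr_pair:
  assumes v: "v \<in> verts F"
  obtains h h' where "h \<in> hedges_at F v" "h' \<in> hedges_at F v" "st h \<noteq> st h'"
proof -
  have card4: "card (hedges_at F v) = 4" using reg v by (simp add: four_regular_def)
  then obtain h where h: "h \<in> hedges_at F v" by fastforce
  then have hF: "h \<in> hedges F" by (simp add: hedges_at_def)
  have "hedges_at F v \<noteq> st h" using card4 ST_card[OF st_in(1)[OF hF]] by auto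
  then obtain h' where h': "h' \<in> hedges_at F v" "h' \<notin> st h" using st_subset_at[OF h] by blast
  then have "st h \<noteq> st h'" using st_in(2) by (auto simp: hedges_at_def)
  then show thesis using that h h'(1) by blast
qed

lemma tr_in_tau: "v \<in> verts F \<Longrightarrow> tr v \<in> tau F P"
  using tr_pair st_pair(3) by metis

text \<open>A transition covers all half-edges at its vertex, and each of these lies in only one
  single transition of \<open>P\<close>; this leaves only \<open>tr v\<close>.\<close>

lemma tauE:
  assumes "t \<in> tau F P"
  obtains v where "v \<in> verts F" "t = tr v"
proof -
  obtain v s1 s2 where v: "v \<in> verts F" and t: "t = {s1, s2}" "s1 \<union> s2 = hedges_at F v"
      "card s1 = 2" "card s2 = 2" and ST: "t \<subseteq> ST"
    using assms by (auto simp: tau_def transition_def single_transition_def)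
  have "s \<in> tr v" if "s \<in> t" for s
  proof -
    have "s \<noteq> {}" using that t by auto
    then obtain h where h: "h \<in> s" by blast
    then have "inc F h = v" using that t(1,2) by (auto simp: hedges_at_def)
    then show ?thesis using mem_tr_iff[of s h v] h that ST by blast
  qed
  moreover have "s \<in> t" if "s \<in> tr v" for s
  proof -
    obtain h where h: "h \<in> hedges_at F v" "s = st h" using \<open>s \<in> tr v\<close> by (auto simp: tr_def)
    then have "h \<in> s1 \<or> h \<in> s2" using t(2) by blast
    then show ?thesis using h(2) ST t(1) st_eq[of s1 h] st_eq[of s2 h] by auto
  qed
  ultimately show thesis using that v by blast
qed

text \<open>A single transition sits at one vertex, and the transition of \<open>P\<close> there is
  its only edge. \<open>P\<close> is finite because its circuits are nonempty, so that each is the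
  image of a single transition.\<close>

lemma wf_Tch: "wf_graph T"
proof -
  have "ST \<subseteq> Pow (hedges F)" using ST_subset by blast
  then have finST: "finite ST" using wf by (auto simp: wf_graph_def intro: finite_subset)
  have "P \<subseteq> inc T ` ST"
  proof
    fix c assume c: "c \<in> P"
    then obtain s where s: "s \<in> strans c" using rep(2,4)[OF c] by fastforce
    then have "c = inc T s" "s \<in> ST" using inc_Tch[OF c] c by auto
    then show "c \<in> inc T ` ST" by (rule image_eqI)
  qed
  then have finP: "finite P" using finST by (meson finite_imageI finite_subset)
  have edges: "card t = 2 \<and> t \<subseteq> ST" if t: "t \<in> tau F P" for t
  proof -
    obtain v where v: "v \<in> verts F" "t = tr v" using tauE[OF t] .
    obtain h h' where h: "h \<in> hedges_at F v" "h' \<in> hedges_at F v" "st h \<noteq> st h'"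
      using tr_pair[OF v(1)] .
    have "card t = 2" using st_pair(1)[OF v(1) h] h(3) v(2) by simp
    moreover have "t \<subseteq> ST" using t by (simp add: tau_def)
    ultimately show ?thesis by simp
  qed
  have ex1: "\<exists>!t. t \<in> tau F P \<and> s \<in> t" if s: "s \<in> ST" for s
  proof -
    obtain h where h: "h \<in> s" using ST_props[OF s] by blast
    have v: "inc F h \<in> verts F" by (rule inc_in_verts[OF wf ST_subset[OF s h]])
    show ?thesis
    proof (rule ex1I[of _ "tr (inc F h)"])
      show "tr (inc F h) \<in> tau F P \<and> s \<in> tr (inc F h)"
        using tr_in_tau[OF v] mem_tr_iff[OF s h] by simp
      fix t assume t: "t \<in> tau F P \<and> s \<in> t"
      then obtain w where "w \<in> verts F" "t = tr w" using tauE by blast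
      then show "t = tr (inc F h)" using t mem_tr_iff[OF s h, of w] by simp
    qed
  qed
  have "inc T ` ST \<subseteq> P" using inc_Tch_in by blast
  then show ?thesis
    unfolding wf_graph_def Tch_simps using finP finST edges ex1 by (intro conjI ballI) simp_all
qed

end

section \<open>Linked lists and further facts on walks\<close>

text \<open>A closed walk is a cyclically linked list. Cut open, it stays linked when trivial steps are
  deleted, by induction on the list.\<close>

fun linked :: "('a \<Rightarrow> 'b) \<Rightarrow> 'b \<Rightarrow> ('a \<times> 'a) list \<Rightarrow> 'b \<Rightarrow> bool" where
  "linked g u [] v \<longleftrightarrow> u = v"
| "linked g u (p # ps) v \<longleftrightarrow> g (fst p) = u \<and> linked g (g (snd p)) ps v"

lemma linked_filter:
  "linked g u ps v \<Longrightarrow> \<forall>p\<in>set ps. \<not> Q p \<longrightarrow> g (fst p) = g (snd p) \<Longrightarrow> linked g u (filter Q ps) v"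
  by (induction ps arbitrary: u) auto

lemma linked_iff_nth:
  "linked g u ps v \<longleftrightarrow>
    (\<forall>i<length ps. g (fst (ps ! i)) = (if i = 0 then u else g (snd (ps ! (i - 1))))) \<and>
    v = (if ps = [] then u else g (snd (ps ! (length ps - 1))))"
proof (induction ps arbitrary: u)
  case (Cons p ps)
  have "(p # ps) ! i = (if i = 0 then p else ps ! (i - 1))" for i by (cases i) auto
  then show ?case unfolding linked.simps Cons
    by (auto simp: All_less_Suc2)
qed auto

lemma linked_cyclic_iff:
  assumes "ps \<noteq> []"
  shows "(\<exists>u. linked g u ps u) \<longleftrightarrow> (\<forall>i<length ps. g (snd (ps ! i)) = g (fst (ps ! ((i + 1) mod length ps))))"
    (is "_ \<longleftrightarrow> ?R")
proof
  let ?n = "length ps"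
  assume "\<exists>u. linked g u ps u"
  then obtain u where "linked g u ps u" by blast
  then have n: "\<And>i. i < ?n \<Longrightarrow> g (fst (ps ! i)) = (if i = 0 then u else g (snd (ps ! (i - 1))))"
    "u = g (snd (ps ! (?n - 1)))"
    using assms unfolding linked_iff_nth by auto
  show ?R
  proof (intro allI impI)
    fix i assume i: "i < ?n"
    show "g (snd (ps ! i)) = g (fst (ps ! ((i + 1) mod ?n)))"
    proof (cases "i + 1 = ?n")
      case True
      then have "i = ?n - 1" by simp
      then show ?thesis using n(1)[of 0] n(2) True assms by simp
    next
      case False
      then have "i + 1 < ?n" using i by simp
      then show ?thesis using n(1)[of "i + 1"] by simp
    qed
  qed
next
  let ?n = "length ps"
  assume R: ?R
  have pos: "0 < ?n" using assms by simp
  have "linked g (g (fst (ps ! 0))) ps (g (fst (ps ! 0)))"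
    unfolding linked_iff_nth
  proof (intro conjI allI impI)
    fix i assume i: "i < ?n"
    show "g (fst (ps ! i)) = (if i = 0 then g (fst (ps ! 0)) else g (snd (ps ! (i - 1))))"
      using R[rule_format, of "i - 1"] i by (cases i) auto
  next
    show "g (fst (ps ! 0)) = (if ps = [] then g (fst (ps ! 0)) else g (snd (ps ! (?n - 1))))"
      using R[rule_format, of "?n - 1"] pos by simp
  qed
  then show "\<exists>u. linked g u ps u" by blast
qed

lemma sigma_tr_Cons:
  "sigma_tr D ((a, b) # ts) e = (if {a, b} = e then if D e = a then 1 else - 1 else 0) + sigma_tr D ts e"
  by (simp add: sigma_tr_def)

lemma flow_Cons: "flow ((a, b) # w) h = of_bool (b = h) - of_bool (a = h) + flow w h"
  by (simp add: flow_def)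

lemma piP_Cons:
  "piP P ((a, b) # w) = (if st_of P a = st_of P b then piP P w else (st_of P a, st_of P b) # piP P w)"
  by (simp add: piP_def)

lemma sigma_tr_outside:
  assumes "trav_walk G ts" "e \<notin> edges G"
  shows "sigma_tr D ts e = 0"
  unfolding sigma_tr_def sum_list_conv_sum_nth
proof (rule sum.neutral, rule ballI)
  fix i assume "i \<in> {..<length ts}"
  then have "{fst (ts ! i), snd (ts ! i)} \<noteq> e" using assms by (auto simp: trav_walk_def)
  then show "(case ts ! i of (a, b) \<Rightarrow> if {a, b} = e then if D e = a then 1 else - 1 else 0) = (0::int)"
    by (simp add: case_prod_beta)
qed

text \<open>A common half-edge puts both circuits into the same component, which has only one
  circuit in \<open>C\<close>.\<close>

lemma euler_disjoint:
  assumes C: "euler_system G C" and ws: "ws \<in> C" "ws' \<in> C"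
    and h: "h \<in> walk_hedges ws" "h \<in> walk_hedges ws'"
  shows "ws = ws'"
proof -
  obtain K K' where K: "K \<in> components G" "walk_hedges ws = comp_hedges G K"
    and K': "K' \<in> components G" "walk_hedges ws' = comp_hedges G K'"
  proof -
    have "\<exists>K\<in>components G. walk_hedges ws = comp_hedges G K"
      "\<exists>K\<in>components G. walk_hedges ws' = comp_hedges G K"
      using C ws by (simp_all add: euler_system_def)
    then show thesis using that by blast
  qed
  have "inc G h \<in> K" "inc G h \<in> K'" using h K K' by (auto simp: comp_hedges_def)
  then have "K = K'"
    using components_eq_component_of[OF K(1), of "inc G h"] components_eq_component_of[OF K'(1), of "inc G h"]
    by simp
  moreover have "\<exists>!ws. ws \<in> C \<and> walk_hedges ws = comp_hedges G K"
    using C K(1) unfolding euler_system_def by simp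
  ultimately show ?thesis using ws K(2) K'(2) by (elim ex1E) metis
qed

section \<open>Lifting to half-edges of \<open>F\<close> and projecting walks\<close>

context partitioned_graph
begin

lemma in_rep:
  assumes "h \<in> hedges F"
  shows "inc T (st h) \<in> P" "h \<in> walk_hedges (rep (inc T (st h)))"
proof -
  note c = inc_Tch_in[OF st_in(1)[OF assms]]
  then show "inc T (st h) \<in> P" by simp
  show "h \<in> walk_hedges (rep (inc T (st h)))"
    using Union_strans[OF c(1)] c(2) st_in(2)[OF assms] by blast
qed

text \<open>The half-edges of the touch-graph at \<open>c\<close> are its single transitions, so the
  sum of \<open>outflow\<close> around \<open>c\<close> is the divergence of \<open>x\<close> there.
  It vanishes, and \<open>circuit_potential\<close> applies.\<close>

lemma circuit_lift:
  fixes x :: "'h set set \<Rightarrow> 'a::comm_ring_1"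
  assumes based: "based F Eb" and D: "orientation T D" and c: "c \<in> P"
    and ker: "(\<Sum>t\<in>tau F P. of_int (incid T D c t) * x t) = 0"
  shows "\<exists>y :: 'h \<Rightarrow> 'a.
    (\<forall>i<length (rep c). y (fst (rep c ! i)) + y (snd (rep c ! i)) =
      outflow T D x {fst (rep c ! i), snd (rep c ! i)}) \<and>
    (\<forall>h h'. h \<in> walk_hedges (rep c) \<longrightarrow> {h, h'} \<in> edges F \<longrightarrow> y h + y h' = 0) \<and>
    (\<forall>e h. e \<in> Eb \<longrightarrow> h \<in> e \<longrightarrow> h \<in> walk_hedges (rep c) \<longrightarrow> y h = 0)"
proof -
  let ?ws = "rep c" and ?g = "\<lambda>p. outflow T D x {fst p, snd p}"
  note cw = rep(1)[OF c] and dist = rep(3)[OF c]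
  have "inj_on (\<lambda>i. {fst (?ws ! i), snd (?ws ! i)}) {..<length ?ws}"
    using hedge_list_distinctD[OF dist] by (auto intro!: inj_onI simp: doubleton_eq_iff)
  then have "(\<Sum>i<length ?ws. ?g (?ws ! i)) = (\<Sum>s\<in>strans c. outflow T D x s)"
    by (simp add: strans_nth[OF c] sum.reindex)
  also have "\<dots> = 0"
    using divergence_eq_sum_outflow[OF wf_Tch D, of c x] ker by (simp add: hedges_at_Tch[OF c] Tch_simps)
  finally have g0: "(\<Sum>i<length ?ws. ?g (?ws ! i)) = 0" .
  \<comment> \<open>The circuit stays in one component and so meets at most one base edge.
    \<open>k\<close> is a half-edge of that edge; the other one is handled by antisymmetry, so
    normalising \<open>y\<close> at \<open>k\<close> is enough.\<close>
  obtain k where k: "\<And>e h. e \<in> Eb \<Longrightarrow> h \<in> e \<Longrightarrow> h \<in> walk_hedges ?ws \<Longrightarrow>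
      k \<in> walk_hedges ?ws \<and> (h = k \<or> {k, h} \<in> edges F)"
  proof (cases "\<exists>e\<in>Eb. \<exists>k\<in>e. k \<in> walk_hedges ?ws")
    case True
    then obtain e k where ek: "e \<in> Eb" "k \<in> e" "k \<in> walk_hedges ?ws" by blast
    have eE: "e \<in> edges F" using based ek(1) by (auto simp: based_def)
    show thesis
    proof (rule that[of k])
      fix e' h assume e': "e' \<in> Eb" "h \<in> e'" "h \<in> walk_hedges ?ws"
      have "e = e'"
        using closed_walk_component[OF wf cw ek(3) e'(3)]
        by (rule based_unique[OF wf based ek(1) e'(1) ek(2) e'(2)])
      moreover obtain k' where "e = {k, k'}" using edgeE[OF wf eE ek(2)] .
      ultimately show "k \<in> walk_hedges ?ws \<and> (h = k \<or> {k, h} \<in> edges F)"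
        using eE e'(2) ek(3) by auto
    qed
  next
    case False
    then show thesis using that by blast
  qed
  obtain y where y1: "\<forall>i<length ?ws. y (fst (?ws ! i)) + y (snd (?ws ! i)) = ?g (?ws ! i)"
    and y2: "\<forall>i<length ?ws. y (snd (?ws ! i)) + y (fst (?ws ! ((i + 1) mod length ?ws))) = 0"
    and y3: "k \<in> walk_hedges ?ws \<longrightarrow> y k = 0"
    using circuit_potential[of ?ws ?g k, OF dist g0] by (elim exE conjE)
  have anti: "y h + y h' = 0" if h: "h \<in> walk_hedges ?ws" "{h, h'} \<in> edges F" for h h'
  proof -
    obtain i where i: "i < length ?ws" "{h, h'} = {snd (?ws ! i), fst (?ws ! ((i + 1) mod length ?ws))}"
      using closed_walk_edge_closed[OF wf cw h] .
    then show ?thesis using y2[rule_format, OF i(1)] by (auto simp: doubleton_eq_iff add.commute)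
  qed
  have "y h = 0" if "e \<in> Eb" "h \<in> e" "h \<in> walk_hedges ?ws" for e h
  proof -
    from k[OF that] have kw: "k \<in> walk_hedges ?ws" and "h = k \<or> {k, h} \<in> edges F" by auto
    then show ?thesis using y3 anti[OF kw, of h] by auto
  qed
  then show ?thesis using y1 anti by (intro exI[of _ y] conjI allI impI) simp_all
qed

text \<open>The circuits of \<open>P\<close> partition the half-edges of \<open>F\<close>, and no
  single transition or edge joins two of them, so the potentials of the circuits can be
  glued.\<close>

lemma lift_exists:
  fixes x :: "'h set set \<Rightarrow> 'a::comm_ring_1"
  assumes based: "based F Eb" and D: "orientation T D"
    and ker: "\<And>c. c \<in> P \<Longrightarrow> (\<Sum>t\<in>tau F P. of_int (incid T D c t) * x t) = 0"
  obtains y :: "'h \<Rightarrow> 'a" where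
    "\<And>s. s \<in> ST \<Longrightarrow> (\<Sum>h\<in>s. y h) = outflow T D x s"
    "\<And>h h'. {h, h'} \<in> edges F \<Longrightarrow> y h + y h' = 0"
    "\<And>e h. e \<in> Eb \<Longrightarrow> h \<in> e \<Longrightarrow> y h = 0"
proof -
  let ?Q = "\<lambda>c y. (\<forall>i<length (rep c). y (fst (rep c ! i)) + y (snd (rep c ! i)) = outflow T D x {fst (rep c ! i), snd (rep c ! i)})
    \<and> (\<forall>h h'. h \<in> walk_hedges (rep c) \<longrightarrow> {h, h'} \<in> edges F \<longrightarrow> y h + y h' = 0)
    \<and> (\<forall>e h. e \<in> Eb \<longrightarrow> h \<in> e \<longrightarrow> h \<in> walk_hedges (rep c) \<longrightarrow> y h = 0)"
  have "\<exists>y. ?Q c y" if c: "c \<in> P" for c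
    by (rule circuit_lift[OF based D c ker[OF c]])
  then have "\<forall>c\<in>P. \<exists>y. ?Q c y" by (rule ballI)
  then obtain Y where "\<forall>c\<in>P. ?Q c (Y c)" unfolding bchoice_iff by (rule exE)
  then have Y: "?Q c (Y c)" if "c \<in> P" for c using that by (rule bspec)
  define y where "y h = Y (inc T (st h)) h" for h
  show thesis
  proof (rule that[of y])
    fix s assume s: "s \<in> ST"
    define c where "c = inc T s"
    have c: "c \<in> P" "s \<in> strans c" using inc_Tch_in[OF s] by (simp_all add: c_def)
    obtain i where i: "i < length (rep c)" "s = {fst (rep c ! i), snd (rep c ! i)}"
      using c strans_nth[OF c(1)] by blast
    have y: "y h = Y c h" if "h \<in> s" for h
      using st_eq[OF s that] by (simp add: y_def c_def)
    have "(\<Sum>h\<in>s. y h) = (\<Sum>h\<in>s. Y c h)" using y by (rule sum.cong[OF refl])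
    also have "\<dots> = Y c (fst (rep c ! i)) + Y c (snd (rep c ! i))"
      unfolding i(2) using closed_walkD(3)[OF rep(1)[OF c(1)] i(1)] by simp
    also have "\<dots> = outflow T D x s" using Y[OF c(1)] i by simp
    finally show "(\<Sum>h\<in>s. y h) = outflow T D x s" .
  next
    fix h h' assume e: "{h, h'} \<in> edges F"
    have h: "h \<in> hedges F" using edge_pairD[OF wf e] by simp
    have "y h' = Y (inc T (st h)) h'" using inc_Tch_edge[OF e] by (simp add: y_def)
    then show "y h + y h' = 0" using Y[OF in_rep(1)[OF h]] in_rep(2)[OF h] e by (simp add: y_def)
  next
    fix e h assume e: "e \<in> Eb" "h \<in> e"
    then have h: "h \<in> hedges F"
      using based by (intro edge_subset_hedges[OF wf _ e(2)]) (auto simp: based_def)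
    then show "y h = 0" using Y[OF in_rep(1)[OF h]] in_rep(2)[OF h] e unfolding y_def by blast
  qed
qed

text \<open>Both sides are additive over the steps of \<open>w\<close>, which is why a list of steps
  at vertices is assumed and the induction may cut the walk. A step into the head transition of
  \<open>t\<close> projects to a traversal along \<open>D\<close>, a step out of it to one against
  \<open>D\<close>, and a step within one single transition counts on neither side.\<close>

lemma sigma_tr_piP:
  assumes D: "orientation T D" and t: "t \<in> tau F P"
    and w: "\<And>a b. (a, b) \<in> set w \<Longrightarrow> a \<in> hedges F \<and> b \<in> hedges F \<and> inc F a = inc F b"
  shows "sigma_tr D (piP P w) t = (\<Sum>h\<in>head D t. flow w h)"
  using w
proof (induction w)
  case Nil
  then show ?case by (simp add: piP_def sigma_tr_def flow_def)
next
  case (Cons p w)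
  obtain a b where p: "p = (a, b)" by (cases p)
  have ab: "a \<in> hedges F" "b \<in> hedges F" "inc F a = inc F b" using Cons.prems p by auto
  have "t \<in> edges T" using t by (simp add: Tch_simps)
  note th = tail_head[OF wf_Tch D this]
  have hST: "head D t \<in> ST" using th(1) t unfolding tau_def by blast
  have fin: "finite (head D t)" using ST_card[OF hST] by (simp add: card_ge_0_finite)
  have mem: "k \<in> head D t \<longleftrightarrow> st k = head D t" if "k \<in> hedges F" for k
    using st_eq[OF hST, of k] st_in(2)[OF that] by auto
  have IH: "sigma_tr D (piP P w) t = (\<Sum>h\<in>head D t. flow w h)"
    by (rule Cons.IH) (rule Cons.prems, simp)
  have "(\<Sum>h\<in>head D t. of_bool (b = h) - of_bool (a = h)) =
      (of_bool (st b = head D t) - of_bool (st a = head D t) :: int)"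
    using fin mem ab by (simp add: sum_subtractf)
  moreover have "of_bool (st b = head D t) - of_bool (st a = head D t) =
     (if st a \<noteq> st b \<and> {st a, st b} = t then if D t = st a then 1 else - 1 else (0::int))"
  proof (cases "st a = st b")
    case False
    have v: "inc F a \<in> verts F" by (rule inc_in_verts[OF wf ab(1)])
    have at: "a \<in> hedges_at F (inc F a)" "b \<in> hedges_at F (inc F a)" using ab by (auto simp: hedges_at_def)
    have "{st a, st b} \<in> edges T" using st_pair[OF v at False] by (simp add: Tch_simps)
    moreover have "t \<in> edges T" using t by (simp add: Tch_simps)
    moreover have "head D t \<in> t" using th(1) by blast
    \<comment> \<open>A half-edge of the touch-graph lies on one edge only, so the step meets the
      head of \<open>t\<close> just when it projects to \<open>t\<close>.\<close>
    ultimately have "st a \<noteq> head D t \<and> st b \<noteq> head D t" if "{st a, st b} \<noteq> t"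
      using edge_unique[OF wf_Tch, of "{st a, st b}" t "head D t"] that by auto
    moreover have "(D t = st a \<and> head D t = st b) \<or> (D t = st b \<and> head D t = st a)" if "{st a, st b} = t"
      using that th(1) by (metis doubleton_eq_iff)
    ultimately show ?thesis using False th(2) by auto
  qed simp
  ultimately show ?case
    unfolding p flow_Cons piP_Cons sum.distrib by (simp add: sigma_tr_Cons IH)
qed

lemma closed_walk_pairs:
  "closed_walk F w \<Longrightarrow> (a, b) \<in> set w \<Longrightarrow> a \<in> hedges F \<and> b \<in> hedges F \<and> inc F a = inc F b"
  by (metis closed_walkD(1,2,4) fst_conv snd_conv in_set_conv_nth)

text \<open>Edges of \<open>F\<close> stay within one circuit of \<open>P\<close>, so the projected
  steps link up cyclically. A deleted step has the same circuit at both ends and leaves no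
  gap.\<close>

lemma piP_trav_walk:
  assumes w: "closed_walk F w"
  shows "trav_walk T (piP P w)"
proof (cases "piP P w = []")
  case False
  let ?n = "length w"
  define ps where "ps = map (\<lambda>(h, h'). (st h, st h')) w"
  have piP: "piP P w = filter (\<lambda>p. fst p \<noteq> snd p) ps"
    unfolding piP_def ps_def by (rule filter_cong) auto
  have "w \<noteq> []" using False by (auto simp: piP_def)
  then have ps: "ps \<noteq> []" by (simp add: ps_def)
  have lt: "(i + 1) mod ?n < ?n" for i using \<open>w \<noteq> []\<close> by simp
  have "inc T (snd (ps ! i)) = inc T (fst (ps ! ((i + 1) mod length ps)))" if "i < length ps" for i
    using inc_Tch_edge[OF closed_walkD(5)[OF w, of i]] that lt[of i] by (simp add: ps_def case_prod_beta)
  then have "\<exists>u. linked (inc T) u ps u" unfolding linked_cyclic_iff[OF ps] by blast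
  then obtain u where "linked (inc T) u ps u" ..
  then have "linked (inc T) u (piP P w) u" unfolding piP by (rule linked_filter) simp
  then have "\<exists>u. linked (inc T) u (piP P w) u" ..
  then have link: "\<forall>i<length (piP P w). inc T (snd (piP P w ! i)) = inc T (fst (piP P w ! ((i + 1) mod length (piP P w))))"
    unfolding linked_cyclic_iff[OF False] .
  have "{fst p, snd p} \<in> edges T \<and> fst p \<noteq> snd p" if p: "p \<in> set (piP P w)" for p
  proof -
    obtain a b where ab: "(a, b) \<in> set w" "p = (st a, st b)" "st a \<noteq> st b"
      using p by (auto simp: piP_def)
    note abF = closed_walk_pairs[OF w ab(1)]
    have v: "inc F a \<in> verts F" using abF inc_in_verts[OF wf] by blast
    have at: "a \<in> hedges_at F (inc F a)" "b \<in> hedges_at F (inc F a)" using abF by (auto simp: hedges_at_def)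
    show ?thesis using st_pair[OF v at ab(3)] ab by (simp add: Tch_simps)
  qed
  then have "{fst (piP P w ! i), snd (piP P w ! i)} \<in> edges T \<and> fst (piP P w ! i) \<noteq> snd (piP P w ! i)"
    if "i < length (piP P w)" for i using nth_mem[OF that] by blast
  then show ?thesis unfolding trav_walk_def using link by blast
qed (simp add: trav_walk_def)

end

section \<open>Integer and rational linear structure\<close>

lemma sum_fun_apply: "(\<Sum>i\<in>A. f i) x = (\<Sum>i\<in>A. f i x)"
  for f :: "'i \<Rightarrow> 'b \<Rightarrow> 'a::comm_monoid_add"
  by (induction A rule: infinite_finite_induct) simp_all

interpretation zmod: module zscale
  by unfold_locales (simp_all add: zscale_def fun_eq_iff algebra_simps)

interpretation qmod: vector_space qscale
  by unfold_locales (simp_all add: qscale_def fun_eq_iff algebra_simps)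

lemma subspace_cycle_space: "qmod.subspace (cycle_space G D)"
proof (rule qmod.subspaceI)
  show "0 \<in> cycle_space G D" by (simp add: cycle_space_def)
  show "x + y \<in> cycle_space G D" if "x \<in> cycle_space G D" "y \<in> cycle_space G D" for x y
    using that by (simp add: cycle_space_def distrib_left sum.distrib)
  show "qscale c x \<in> cycle_space G D" if "x \<in> cycle_space G D" for c x
    using that by (simp add: cycle_space_def qscale_def mult.left_commute[of _ c] flip: sum_distrib_left)
qed

section \<open>Cycles of the touch-graph as combinations of induced circuits\<close>

context partitioned_graph
begin

text \<open>The half-edges at \<open>v\<close> split into the head and the tail of
  \<open>tr v\<close>, over which \<open>y\<close> sums to opposite values. So \<open>y\<close> is
  conservative.\<close>

lemma sum_hedges_at_eq_zero:
  fixes y :: "'h \<Rightarrow> 'a::comm_ring_1"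
  assumes D: "orientation T D" and y: "\<And>s. s \<in> ST \<Longrightarrow> (\<Sum>h\<in>s. y h) = outflow T D x s"
    and v: "v \<in> verts F"
  shows "(\<Sum>h\<in>hedges_at F v. y h) = 0"
proof -
  obtain h h' where h: "h \<in> hedges_at F v" "h' \<in> hedges_at F v" "st h \<noteq> st h'" using tr_pair[OF v] .
  have hF: "h \<in> hedges F" "h' \<in> hedges F" using h by (auto simp: hedges_at_def)
  note p = st_pair[OF v h]
  have fin: "finite (st h)" "finite (st h')"
    using ST_card[OF st_in(1)[OF hF(1)]] ST_card[OF st_in(1)[OF hF(2)]] by (simp_all add: card_ge_0_finite)
  have "(\<Sum>h\<in>hedges_at F v. y h) = (\<Sum>h\<in>st h. y h) + (\<Sum>h\<in>st h'. y h)"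
    unfolding p(2)[symmetric] by (intro sum.union_disjoint fin st_disjoint[OF hF h(3)])
  also have "\<dots> = outflow T D x (st h) + outflow T D x (st h')"
    by (simp only: y[OF st_in(1)[OF hF(1)]] y[OF st_in(1)[OF hF(2)]])
  also have "\<dots> = 0"
  proof -
    have e: "tr v \<in> edges T" using p(3) by (simp add: Tch_simps)
    note th = tail_head[OF wf_Tch D e] and o = outflow_tail_head[OF wf_Tch D e, of x]
    have "{st h, st h'} = {D (tr v), head D (tr v)}" using th(1) p(1) by simp
    then consider "st h = D (tr v)" "st h' = head D (tr v)" | "st h' = D (tr v)" "st h = head D (tr v)"
      by (auto simp: doubleton_eq_iff)
    then show ?thesis by cases (simp_all add: o)
  qed
  finally show ?thesis .
qed

text \<open>Along an Euler circuit the flow of an induced circuit only jumps at the two visits of its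
  vertex, once up and once down; the jumps of any conservative \<open>y\<close> at these two visits are
  opposite as well.\<close>

lemma induced_coefficient:
  fixes y :: "'h \<Rightarrow> 'a::comm_ring_1"
  assumes based: "based F Eb" and C: "euler_system F C" and v: "v \<in> verts F"
    and y0: "(\<Sum>h\<in>hedges_at F v. y h) = 0"
  shows "\<exists>a. \<forall>ws\<in>C. \<forall>m<length ws.
    a * of_int (flow (induced F Eb C v) (fst (ws ! m)) + flow (induced F Eb C v) (snd (ws ! m))) =
    (if inc F (fst (ws ! m)) = v then y (fst (ws ! m)) + y (snd (ws ! m)) else 0)"
proof -
  obtain ws0 i j where ws0: "ws0 \<in> C" and ij: "i < length ws0" "j < length ws0" "i \<noteq> j"
    and inc: "inc F (fst (ws0 ! i)) = v" "inc F (fst (ws0 ! j)) = v"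
    and ind: "induced F Eb C v = seg ws0 i j"
    and "\<forall>t\<in>set (traversals (seg ws0 i j)). {fst t, snd t} \<notin> Eb"
    using induced_segment[OF wf reg based C v] .
  have circ: "oriented_circuit F ws" if "ws \<in> C" for ws
    using C that by (simp add: euler_system_def)
  have cw: "closed_walk F ws" if "ws \<in> C" for ws
    using circ[OF that] by (simp add: oriented_circuit_def)
  have mem: "fst (ws ! m) \<in> walk_hedges ws" "snd (ws ! m) \<in> walk_hedges ws" if "m < length ws" for ws m
    using nth_mem[OF that] by (auto simp: walk_hedges_def set_hedge_list)
  have at: "fst (ws ! m) \<in> hedges_at F v"
    if "ws \<in> C" "m < length ws" "inc F (fst (ws ! m)) = v" for ws m
    using closed_walkD(1)[OF cw[OF that(1)] that(2)] that(3) by (simp add: hedges_at_def)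
  obtain ws1 where ws1: "ws1 \<in> C" "hedges_at F v \<subseteq> walk_hedges ws1"
    using euler_circuit_at[OF wf C v] .
  \<comment> \<open>The circuit of the segment comes out of a choice; a shared half-edge identifies
    it with the Euler circuit through all half-edges at \<open>v\<close>.\<close>
  have "ws1 = ws0"
    using ws1(2) at[OF ws0 ij(1) inc(1)] by (intro euler_disjoint[OF C ws1(1) ws0 _ mem(1)[OF ij(1)]]) auto
  then have sub: "hedges_at F v \<subseteq> walk_hedges ws0" using ws1(2) by simp
  obtain i' j' where ij': "i' < length ws0" "j' < length ws0" "i' \<noteq> j'"
      "{k. k < length ws0 \<and> inc F (fst (ws0 ! k)) = v} = {i', j'}"
      "hedges_at F v = {fst (ws0 ! i'), snd (ws0 ! i'), fst (ws0 ! j'), snd (ws0 ! j')}"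
    using euler_vertex_visits[OF reg circ[OF ws0] v sub] .
  have visits: "k < length ws0 \<and> inc F (fst (ws0 ! k)) = v \<longleftrightarrow> k = i' \<or> k = j'" for k
    using ij'(4) by (simp add: set_eq_iff)
  have ij_eq: "i = i' \<and> j = j' \<or> i = j' \<and> j = i'"
    using visits[of i] visits[of j] ij inc by auto
  have dist: "distinct (hedge_list ws0)" using circ[OF ws0] by (simp add: oriented_circuit_def)
  have "(\<Sum>h\<in>hedges_at F v. y h) =
      y (fst (ws0 ! i')) + y (snd (ws0 ! i')) + (y (fst (ws0 ! j')) + y (snd (ws0 ! j')))"
    unfolding ij'(5) using ij'(3) hedge_list_distinctD[OF dist ij'(1,2)] hedge_list_distinctD[OF dist ij'(2,1)]
      hedge_list_distinctD[OF dist ij'(1,1)] hedge_list_distinctD[OF dist ij'(2,2)]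
    by (simp add: add.assoc)
  then have sum0: "y (fst (ws0 ! i')) + y (snd (ws0 ! i')) + (y (fst (ws0 ! j')) + y (snd (ws0 ! j'))) = 0"
    using y0 by simp
  have jump: "y (fst (ws0 ! j)) + y (snd (ws0 ! j)) = - (y (fst (ws0 ! i)) + y (snd (ws0 ! i)))"
    using ij_eq minus_unique[OF sum0, symmetric] eq_neg_iff_add_eq_0[THEN iffD2, OF sum0]
    by (elim disjE conjE) simp_all
  show ?thesis
  \<comment> \<open>The coefficient is the jump of \<open>y\<close> at visit \<open>i\<close>, where
    the induced flow jumps by 1. At visit \<open>j\<close> both jumps change sign.\<close>
  proof (intro exI[of _ "y (fst (ws0 ! i)) + y (snd (ws0 ! i))"] ballI allI impI)
    fix ws m assume ws: "ws \<in> C" and m: "m < length ws"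
    show "(y (fst (ws0 ! i)) + y (snd (ws0 ! i))) *
        of_int (flow (induced F Eb C v) (fst (ws ! m)) + flow (induced F Eb C v) (snd (ws ! m))) =
      (if inc F (fst (ws ! m)) = v then y (fst (ws ! m)) + y (snd (ws ! m)) else 0)"
    proof (cases "ws = ws0")
      case True
      have "flow (induced F Eb C v) (fst (ws ! m)) + flow (induced F Eb C v) (snd (ws ! m)) =
          of_bool (m = i) - of_bool (m = j)"
        unfolding ind True using m True by (intro flow_seg[OF circ[OF ws0] ij]) simp
      moreover have "inc F (fst (ws ! m)) = v \<longleftrightarrow> m = i \<or> m = j"
        using visits[of m] m True ij_eq by auto
      ultimately show ?thesis using jump ij(3) True by auto
    next
      case False
      \<comment> \<open>A different Euler circuit is disjoint from \<open>ws0\<close>, so it misses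
        \<open>v\<close> and carries no induced flow; both sides are zero.\<close>
      have notin: "h \<notin> walk_hedges ws0" if "h \<in> walk_hedges ws" for h
        using euler_disjoint[OF C ws ws0 that] False by blast
      have "flow (induced F Eb C v) h = 0" if "h \<in> walk_hedges ws" for h
        unfolding ind using walk_hedges_seg[OF ij(1,2)] notin[OF that] by (intro flow_eq_zero) auto
      moreover have "inc F (fst (ws ! m)) \<noteq> v"
        using at[OF ws m] sub notin[OF mem(1)[OF m]] by blast
      ultimately show ?thesis using mem[OF m] by simp
    qed
  qed
qed

lemma induced_closed_walk:
  assumes based: "based F Eb" and C: "euler_system F C" and v: "v \<in> verts F"
  shows "closed_walk F (induced F Eb C v)"
    "e \<in> Eb \<Longrightarrow> h \<in> e \<Longrightarrow> flow (induced F Eb C v) h = 0"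
proof -
  obtain ws i j where ws: "ws \<in> C" and ij: "i < length ws" "j < length ws" "i \<noteq> j"
    and inc: "inc F (fst (ws ! i)) = v" "inc F (fst (ws ! j)) = v"
    and ind: "induced F Eb C v = seg ws i j"
    and avoid: "\<forall>t\<in>set (traversals (seg ws i j)). {fst t, snd t} \<notin> Eb"
    using induced_segment[OF wf reg based C v] .
  have "oriented_circuit F ws" using C ws by (simp add: euler_system_def)
  then show cw: "closed_walk F (induced F Eb C v)"
    unfolding ind using ij inc by (intro seg_closed_walk) simp_all
  assume e: "e \<in> Eb" "h \<in> e"
  have "e \<in> edges F" using based e(1) by (auto simp: based_def)
  moreover have "\<forall>t\<in>set (traversals (induced F Eb C v)). {fst t, snd t} \<noteq> e"
    using avoid e(1) unfolding ind by blast
  ultimately show "flow (induced F Eb C v) h = 0"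
    using flow_zero_outside[OF wf cw _ e(2)] by blast
qed

text \<open>By antisymmetry and the absence of jumps, the value at exits is constant around an Euler
  circuit. The base edge of the component makes it zero.\<close>

lemma vanishing_on_euler_circuits:
  fixes z :: "'h \<Rightarrow> 'a::comm_ring_1"
  assumes based: "based F Eb" and C: "euler_system F C"
    and z1: "\<And>ws m. ws \<in> C \<Longrightarrow> m < length ws \<Longrightarrow> z (fst (ws ! m)) + z (snd (ws ! m)) = 0"
    and z2: "\<And>h h'. {h, h'} \<in> edges F \<Longrightarrow> z h + z h' = 0"
    and z3: "\<And>e h. e \<in> Eb \<Longrightarrow> h \<in> e \<Longrightarrow> z h = 0"
    and h: "h \<in> hedges F"
  shows "z h = 0"
proof -
  let ?K = "component_of F (inc F h)"
  have v: "inc F h \<in> verts F" by (rule inc_in_verts[OF wf h])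
  obtain ws where ws: "ws \<in> C" "oriented_circuit F ws" "walk_hedges ws = comp_hedges F ?K"
    "hedges_at F (inc F h) \<subseteq> walk_hedges ws"
    using euler_circuit_at[OF wf C v] .
  have cw: "closed_walk F ws" using ws(2) by (simp add: oriented_circuit_def)
  have fs: "z (fst (ws ! i)) = - z (snd (ws ! i))" if "i < length ws" for i
    using z1[OF ws(1) that] by (simp add: eq_neg_iff_add_eq_0)
  have const: "z (snd (ws ! i)) = z (snd (ws ! ((i + 1) mod length ws)))" if i: "i < length ws" for i
  proof -
    have "(i + 1) mod length ws < length ws" using i by (intro mod_less_divisor) linarith
    then show ?thesis using z2[OF closed_walkD(5)[OF cw i]] fs by simp
  qed
  have "\<exists>!e. e \<in> Eb \<and> e \<in> comp_edges F ?K"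
    using based component_of_in[OF v] by (simp add: based_def)
  then obtain e where e: "e \<in> Eb" "e \<in> comp_edges F ?K" by blast
  then have eE: "e \<in> edges F" by (simp add: comp_edges_def)
  then have "card e = 2" using wf by (simp add: wf_graph_def)
  then have "e \<noteq> {}" by auto
  then obtain k where k: "k \<in> e" by blast
  then have "k \<in> walk_hedges ws"
    using e(2) edge_subset_hedges[OF wf eE k] unfolding ws(3) by (simp add: comp_hedges_def comp_edges_def)
  then obtain i where i: "i < length ws" "k = fst (ws ! i) \<or> k = snd (ws ! i)"
    unfolding walk_hedges_def by (rule set_hedge_list_nthE)
  then have zi: "z (snd (ws ! i)) = 0" using z3[OF e(1) k] fs[OF i(1)] by auto
  have "h \<in> walk_hedges ws" using h ws(4) by (auto simp: hedges_at_def)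
  then obtain l where l: "l < length ws" "h = fst (ws ! l) \<or> h = snd (ws ! l)"
    unfolding walk_hedges_def by (rule set_hedge_list_nthE)
  have "z (snd (ws ! l)) = z (snd (ws ! i))"
    by (rule cyclic_constant[of "length ws" "\<lambda>i. z (snd (ws ! i))", OF const l(1) i(1)])
  then show ?thesis using zi l fs[OF l(1)] by auto
qed

text \<open>Kept over an arbitrary commutative ring: the integers yield integrality and the
  rationals the span.\<close>

lemma induced_combination:
  fixes x :: "'h set set \<Rightarrow> 'a::comm_ring_1"
  assumes based: "based F Eb" and C: "euler_system F C" and D: "orientation T D"
    and ker: "\<And>c. c \<in> P \<Longrightarrow> (\<Sum>t\<in>tau F P. of_int (incid T D c t) * x t) = 0"
  shows "\<exists>a. \<forall>t\<in>tau F P. x t = (\<Sum>v\<in>verts F. a v * of_int (sigma_tr D (piP P (induced F Eb C v)) t))"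
proof -
  let ?f = "\<lambda>v. flow (induced F Eb C v)"
  obtain y :: "'h \<Rightarrow> 'a" where y1: "\<And>s. s \<in> ST \<Longrightarrow> (\<Sum>h\<in>s. y h) = outflow T D x s"
    and y2: "\<And>h h'. {h, h'} \<in> edges F \<Longrightarrow> y h + y h' = 0"
    and y3: "\<And>e h. e \<in> Eb \<Longrightarrow> h \<in> e \<Longrightarrow> y h = 0"
    using lift_exists[OF based D ker] by blast
  have finV: "finite (verts F)" using wf by (simp add: wf_graph_def)
  let ?R = "\<lambda>v a. \<forall>ws\<in>C. \<forall>m<length ws. a * of_int (?f v (fst (ws ! m)) + ?f v (snd (ws ! m))) =
    (if inc F (fst (ws ! m)) = v then y (fst (ws ! m)) + y (snd (ws ! m)) else 0)"
  have "\<forall>v\<in>verts F. \<exists>a. ?R v a"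
    by (intro ballI induced_coefficient[OF based C] sum_hedges_at_eq_zero[OF D y1])
  then obtain a where a: "\<forall>v\<in>verts F. ?R v (a v)" unfolding bchoice_iff by (rule exE)
  \<comment> \<open>The lift of \<open>x\<close> minus the proposed combination; it has no jumps, is
    antisymmetric and vanishes on \<open>Eb\<close>.\<close>
  define z where "z h = y h - (\<Sum>v\<in>verts F. a v * of_int (?f v h))" for h
  have zsum: "z h + z h' = y h + y h' - (\<Sum>v\<in>verts F. a v * of_int (?f v h + ?f v h'))" for h h'
    by (simp add: z_def distrib_left sum.distrib)
  have z0: "z h = 0" if "h \<in> hedges F" for h
  proof (rule vanishing_on_euler_circuits[OF based C _ _ _ that])
    fix ws m assume ws: "ws \<in> C" "m < length ws"
    have "oriented_circuit F ws" using C ws(1) by (simp add: euler_system_def)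
    then have "fst (ws ! m) \<in> hedges F" using ws(2) by (simp add: oriented_circuit_def closed_walkD)
    then have v: "inc F (fst (ws ! m)) \<in> verts F" by (rule inc_in_verts[OF wf])
    have "(\<Sum>v\<in>verts F. a v * of_int (?f v (fst (ws ! m)) + ?f v (snd (ws ! m)))) =
        (\<Sum>v\<in>verts F. if inc F (fst (ws ! m)) = v then y (fst (ws ! m)) + y (snd (ws ! m)) else 0)"
      using a ws by (intro sum.cong refl) blast
    \<comment> \<open>Among the induced flows only that of the vertex visited here has its jump
      matched with \<open>y\<close>; the other terms are zero.\<close>
    also have "\<dots> = y (fst (ws ! m)) + y (snd (ws ! m))" using v finV by simp
    finally show "z (fst (ws ! m)) + z (snd (ws ! m)) = 0" unfolding zsum by simp
  next
    fix h h' assume e: "{h, h'} \<in> edges F"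
    have "?f v h + ?f v h' = 0" if "v \<in> verts F" for v
      using flow_antisym[OF wf induced_closed_walk(1)[OF based C that] e] by simp
    then show "z h + z h' = 0" unfolding zsum using y2[OF e] by simp
  next
    fix e h assume "e \<in> Eb" "h \<in> e"
    then show "z h = 0" unfolding z_def using y3 induced_closed_walk(2)[OF based C] by simp
  qed
  have "x t = (\<Sum>v\<in>verts F. a v * of_int (sigma_tr D (piP P (induced F Eb C v)) t))" if t: "t \<in> tau F P" for t
  proof -
    have e: "t \<in> edges T" using t by (simp add: Tch_simps)
    have "head D t \<in> t" using tail_head(1)[OF wf_Tch D e] by blast
    then have hST: "head D t \<in> ST" using t unfolding tau_def by blast
    \<comment> \<open>At the head \<open>outflow\<close> has sign plus, so summing \<open>y\<close>
      there returns \<open>x t\<close>, while summing the flows returns \<open>sigma_tr\<close> of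
      the projections.\<close>
    have "x t = (\<Sum>h\<in>head D t. y h)"
      using y1[OF hST] outflow_tail_head(2)[OF wf_Tch D e, of x] by simp
    also have "\<dots> = (\<Sum>h\<in>head D t. \<Sum>v\<in>verts F. a v * of_int (?f v h))"
      using z0 ST_subset[OF hST] by (intro sum.cong) (auto simp: z_def)
    also have "\<dots> = (\<Sum>v\<in>verts F. \<Sum>h\<in>head D t. a v * of_int (?f v h))" by (rule sum.swap)
    also have "\<dots> = (\<Sum>v\<in>verts F. a v * of_int (sigma_tr D (piP P (induced F Eb C v)) t))"
    proof (rule sum.cong[OF refl])
      fix v assume v: "v \<in> verts F"
      have "sigma_tr D (piP P (induced F Eb C v)) t = (\<Sum>h\<in>head D t. ?f v h)"
        by (rule sigma_tr_piP[OF D t closed_walk_pairs[OF induced_closed_walk(1)[OF based C v]]])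
      then show "(\<Sum>h\<in>head D t. a v * of_int (?f v h)) = a v * of_int (sigma_tr D (piP P (induced F Eb C v)) t)"
        by (simp add: sum_distrib_left)
    qed
    finally show ?thesis .
  qed
  then show ?thesis by blast
qed

section \<open>Integrality and spanning\<close>

lemma Tch_edge_card: "t \<in> edges T \<Longrightarrow> card t = 2"
  using wf_Tch by (simp add: wf_graph_def)

lemma sigma_tr_in_kernel:
  assumes "orientation T D" "trav_walk T ts"
  shows "(\<Sum>t\<in>tau F P. incid T D c t * sigma_tr D ts t) = 0"
  using trav_walk_kernel[OF finite_edges[OF wf_Tch] assms] by (simp add: Tch_simps)

lemma qvec_sigma_tr_in_cycle_space:
  assumes "orientation T D" "trav_walk T ts"
  shows "qvec (sigma_tr D ts) \<in> cycle_space T D"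
proof -
  have "(\<Sum>t\<in>tau F P. of_int (incid T D c t) * qvec (sigma_tr D ts) t) = 0" for c
    using arg_cong[OF sigma_tr_in_kernel[OF assms, of c], of "of_int :: int \<Rightarrow> rat"]
    by (simp add: qvec_def)
  moreover have "qvec (sigma_tr D ts) t = 0" if "t \<notin> edges T" for t
    using sigma_tr_outside[OF assms(2) that] by (simp add: qvec_def)
  ultimately show ?thesis unfolding cycle_space_def by (simp add: Tch_simps)
qed

text \<open>The vector of a closed walk lies in the kernel over the integers, so
  \<open>induced_combination\<close> supplies integer coefficients.\<close>

lemma integral_Gamma:
  assumes based: "based F Eb" and C: "euler_system F C" and D: "orientation T D"
  shows "integral T D (image_mset (piP P) (Gamma F Eb C))"
  unfolding integral_def
proof (intro allI impI)
  let ?\<gamma> = "\<lambda>v. piP P (induced F Eb C v)"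
  have set: "set_mset (image_mset (piP P) (Gamma F Eb C)) = ?\<gamma> ` verts F"
    using wf by (simp add: Gamma_def wf_graph_def image_image)
  fix W assume W: "closed_walk T W"
  have tw: "trav_walk T (traversals W)" by (rule closed_walk_trav_walk[OF Tch_edge_card W])
  have "(\<Sum>t\<in>tau F P. of_int (incid T D c t) * sigma D W t) = 0" for c
    using sigma_tr_in_kernel[OF D tw] by (simp add: sigma_def)
  then obtain a where a: "\<forall>t\<in>tau F P. sigma D W t = (\<Sum>v\<in>verts F. a v * of_int (sigma_tr D (?\<gamma> v) t))"
    using induced_combination[OF based C D] by blast
  have "sigma D W = (\<Sum>v\<in>verts F. zscale (a v) (sigma_tr D (?\<gamma> v)))"
  proof
    fix t
    show "sigma D W t = (\<Sum>v\<in>verts F. zscale (a v) (sigma_tr D (?\<gamma> v))) t"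
    \<comment> \<open>Vectors are functions on all sets, so equality is also checked off the edges,
      where every term vanishes.\<close>
    proof (cases "t \<in> tau F P")
      case False
      then have out: "t \<notin> edges T" by (simp add: Tch_simps)
      have "sigma_tr D (?\<gamma> v) t = 0" if "v \<in> verts F" for v
        by (rule sigma_tr_outside[OF piP_trav_walk[OF induced_closed_walk(1)[OF based C that]] out])
      then show ?thesis
        using sigma_tr_outside[OF tw out] by (simp add: sigma_def sum_fun_apply zscale_def)
    qed (use a in \<open>simp add: sum_fun_apply zscale_def\<close>)
  qed
  also have "\<dots> \<in> zmod.span (sigma_tr D ` ?\<gamma> ` verts F)"
    by (intro zmod.span_sum zmod.span_scale zmod.span_base imageI)
  finally show "sigma D W \<in> zmod.span (sigma_tr D ` set_mset (image_mset (piP P) (Gamma F Eb C)))"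
    unfolding set .
qed

text \<open>Projected walks are cycles, which gives one inclusion;
  \<open>induced_combination\<close> with rational coefficients gives the other. A basis is then
  extracted from the spanning set.\<close>

lemma cycle_spanning_set_Gamma:
  assumes based: "based F Eb" and C: "euler_system F C" and D: "orientation T D"
  shows "cycle_spanning_set T D (image_mset (piP P) (Gamma F Eb C))"
proof -
  let ?\<gamma> = "\<lambda>v. piP P (induced F Eb C v)"
  let ?q = "qvec \<circ> sigma_tr D"
  define S where "S = ?\<gamma> ` verts F"
  have set: "set_mset (image_mset (piP P) (Gamma F Eb C)) = S"
    using wf by (simp add: Gamma_def wf_graph_def image_image S_def)
  have tw: "trav_walk T W" if "W \<in> S" for W
    using that piP_trav_walk[OF induced_closed_walk(1)[OF based C]] by (auto simp: S_def)
  have "?q ` S \<subseteq> cycle_space T D" using qvec_sigma_tr_in_cycle_space[OF D tw] by auto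
  then have sub: "qmod.span (?q ` S) \<subseteq> cycle_space T D"
    by (rule qmod.span_minimal[OF _ subspace_cycle_space])
  have sup: "cycle_space T D \<subseteq> qmod.span (?q ` S)"
  proof
    fix x assume x: "x \<in> cycle_space T D"
    have "(\<Sum>t\<in>tau F P. of_int (incid T D c t) * x t) = 0" if "c \<in> P" for c
      using x that by (simp add: cycle_space_def Tch_simps)
    then obtain a where a: "\<forall>t\<in>tau F P. x t = (\<Sum>v\<in>verts F. a v * of_int (sigma_tr D (?\<gamma> v) t))"
      using induced_combination[OF based C D, of x] by blast
    have "x = (\<Sum>v\<in>verts F. qscale (a v) (?q (?\<gamma> v)))"
    proof
      fix t
      show "x t = (\<Sum>v\<in>verts F. qscale (a v) (?q (?\<gamma> v))) t"
      proof (cases "t \<in> tau F P")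
        case False
        then have out: "t \<notin> edges T" by (simp add: Tch_simps)
        have "sigma_tr D (?\<gamma> v) t = 0" if "v \<in> verts F" for v
          by (rule sigma_tr_outside[OF piP_trav_walk[OF induced_closed_walk(1)[OF based C that]] out])
        moreover have "x t = 0" using x out by (simp add: cycle_space_def)
        ultimately show ?thesis by (simp add: sum_fun_apply qscale_def qvec_def)
      qed (use a in \<open>simp add: sum_fun_apply qscale_def qvec_def\<close>)
    qed
    also have "\<dots> \<in> qmod.span (?q ` S)"
      unfolding S_def by (intro qmod.span_sum qmod.span_scale qmod.span_base imageI)
    finally show "x \<in> qmod.span (?q ` S)" .
  qed
  obtain V where V: "V \<subseteq> ?q ` S" "qmod.independent V" "?q ` S \<subseteq> qmod.span V"
    using qmod.maximal_independent_subset[of "?q ` S"] by blast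
  \<comment> \<open>One walk is kept for each basis vector, so that different walks in
    \<open>B\<close> have different vectors.\<close>
  obtain B where B: "B \<subseteq> S" "inj_on ?q B" "V = ?q ` B"
    using V(1) unfolding subset_image_inj by blast
  have "qmod.span V = qmod.span (?q ` S)"
    using V(1,3) by (intro equalityI qmod.span_mono qmod.span_minimal qmod.subspace_span)
  then have "cycle_basis T D B"
    unfolding cycle_basis_def
    using B V(2) tw sub sup by (auto dest: inj_on_imageI2)
  then show ?thesis unfolding cycle_spanning_set_def set using tw B(1) by blast
qed

end

theorem mainTheorem17:
  fixes F :: "('v, 'h) graph"
    and Eb :: "'h set set"
    and P :: "('h \<times> 'h) list set set"
    and C :: "('h \<times> 'h) list set"
  assumes "wf_graph F"
    and "four_regular F"
    and "based F Eb"
    and "circuit_partition F P"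
    and "euler_system F C"
  shows "integral_cycle_spanning_set (Tch F P) (image_mset (piP P) (Gamma F Eb C))"
proof -
  interpret partitioned_graph F P
    using assms(1,2,4) by unfold_locales
  show ?thesis
    unfolding integral_cycle_spanning_set_def
    using cycle_spanning_set_Gamma[OF assms(3,5)] integral_Gamma[OF assms(3,5)] by blast
qed

end
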